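(* Let $CP_3(n)$ be defined by $\sum_{n\ge 0} CP_3(n)q^n = \dfrac{f_3^6f_6^6}{f_1^2f_2^2}$. Then \[ \sum_{n=0}^\infty CP_3(2n)q^n = \frac{f_2^6f_3^{10}}{f_1^6f_6^2}+q\frac{f_3^6f_6^6}{f_1^2f_2^2},\qquad \sum_{n=0}^\infty CP_3(2n+1)q^n = 2\frac{f_2^2f_3^8f_6^2}{f_1^4}. \]
   Context: For $|q|<1$ and integer $m\ge 1$, $f_m := (q^m;q^m)_\infty=\prod_{n\ge1}(1-q^{mn})$. $CP_3(n)$ is the number of $3$-core cubic bipartitions of $n$, defined by the generating function $\sum_{n\ge0}CP_3(n)q^n = \frac{f_3^6f_6^6}{f_1^2f_2^2}$. Identities are of formal power series in $q$. *)

theory Defs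
  imports "HOL-Analysis.Infinite_Products" "HOL-Computational_Algebra.Formal_Power_Series"
begin

text \<open>
  Coefficients are taken in the rationals so that the library division of formal power series
  is available; all denominators below have constant coefficient 1. The infinite product is
  taken in the usual (q-adic) topology on formal power series, and \<open>euler_f_has_prod\<close>
  shows that it really converges, so \<open>prodinf\<close> is not a default value.
\<close>

definition euler_f :: "nat \<Rightarrow> rat fps" where
  "euler_f m = (\<Prod>n. 1 - fps_X ^ (m * Suc n))"

definition CP3_gf :: "rat fps" where
  "CP3_gf = (euler_f 3 ^ 6 * euler_f 6 ^ 6) / (euler_f 1 ^ 2 * euler_f 2 ^ 2)"

definition CP3 :: "nat \<Rightarrow> rat" where
  "CP3 n = fps_nth CP3_gf n"

lemma euler_f_has_prod:
  assumes "m \<ge> 1"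
  shows "(\<lambda>n. 1 - fps_X ^ (m * Suc n)) has_prod euler_f m"
    and "fps_nth (euler_f m) 0 = 1"
proof -
  define a where "a = (\<lambda>n. 1 - fps_X ^ (m * Suc n) :: rat fps)"
  define P where "P = Abs_fps (\<lambda>k. fps_nth (\<Prod>i\<le>k. a i) k)"
  have shift: "fps_nth (\<Prod>i\<le>Suc n. a i) k = fps_nth (\<Prod>i\<le>n. a i) k" if "k \<le> n" for n k
  proof -
    have "n < m * Suc (Suc n)"
      using assms by (cases m) auto
    then have "k < m * Suc (Suc n)"
      using that by linarith
    then have "fps_nth ((\<Prod>i\<le>n. a i) * fps_X ^ (m * Suc (Suc n))) k = 0"
      by (simp only: fps_X_power_mult_right_nth if_True)
    then show ?thesis
      by (simp only: prod.atMost_Suc a_def right_diff_distrib mult_1_right fps_sub_nth diff_zero)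
  qed
  have stable: "fps_nth (\<Prod>i\<le>n. a i) k = fps_nth P k" if "k \<le> n" for n k
    using that
  proof (induction n rule: dec_induct)
    case base
    show ?case by (simp add: P_def)
  next
    case (step n)
    then show ?case using shift by simp
  qed
  have lim: "(\<lambda>n. \<Prod>i\<le>n. a i) \<longlonglongrightarrow> P"
    using stable by (intro tendsto_fpsI) (auto simp: eventually_at_top_linorder)
  have P0: "fps_nth P 0 = 1"
    using assms by (simp add: P_def a_def)
  then have "P \<noteq> 0"
    by auto
  then have hp: "a has_prod P"
    using lim by (simp add: has_prod_def raw_has_prod_def)
  have "prodinf a = P"
    unfolding prodinf_def using hp has_prod_unique2 by blast
  then have "euler_f m = P"
    by (simp add: euler_f_def a_def)
  with hp P0 show "(\<lambda>n. 1 - fps_X ^ (m * Suc n)) has_prod euler_f m"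
    and "fps_nth (euler_f m) 0 = 1"
    by (simp_all add: a_def)
qed

end

theory Submission
  imports Defs
begin

text \<open>
  Everything follows from the 2-dissection of \<open>F = f\<^sub>3\<^sup>3 / f\<^sub>1\<close>,
  namely \<open>F = f\<^sub>4\<^sup>3 f\<^sub>6\<^sup>2 / (f\<^sub>2\<^sup>2 f\<^sub>1\<^sub>2) + q f\<^sub>1\<^sub>2\<^sup>3 / f\<^sub>4\<close>: square it,
  multiply by \<open>f\<^sub>6\<^sup>6 / f\<^sub>2\<^sup>2\<close> and separate even and odd powers of \<open>q\<close>.

  For the dissection, let \<open>w\<close> be a primitive cube root of unity. By the Jacobi triple product,
  \<open>\<Sum> (- w)\<^sup>n q^(n (n + 1) / 2) = (1 - w\<^sup>2) f\<^sub>3\<close>. Multiplying this with its conjugate and summing over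
  \<open>(i, j)\<close> with \<open>i + j\<close> even and odd separately gives \<open>3 F = S(q) + T(q)\<close>, where
  \<open>S(q) = (\<Sum> q^(n\<^sup>2)) (\<Sum> q^(3 n\<^sup>2 + 2 n))\<close> and \<open>T(q) = (\<Sum> q^(n\<^sup>2 + n)) (\<Sum> q^(3 n\<^sup>2 + n))\<close>.
  The exponents of \<open>S\<close> are values of \<open>i\<^sup>2 + 3 j\<^sup>2 + 2 j\<close>. The lattice points with \<open>i + j\<close> even contribute
  \<open>T(q) / 2\<close> and those with \<open>i + j\<close> odd contribute \<open>q (S + T)(q\<^sup>4) = 3 q F(q\<^sup>4)\<close>. Hence
  \<open>F(q) = T(q) / 2 + q F(q\<^sup>4)\<close>, and the triple product evaluates \<open>T\<close>.
\<close>

text \<open>A coefficient of a product depends on finitely many coefficients of the factors, and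
  each of these is eventually constant.\<close>

lemma tendsto_mult_fps:
  fixes a b :: "'a :: comm_ring_1 fps"
  assumes "f \<longlonglongrightarrow> a" "g \<longlonglongrightarrow> b"
  shows "(\<lambda>n. f n * g n) \<longlonglongrightarrow> a * b"
proof (rule tendsto_fpsI)
  fix k
  have "\<forall>\<^sub>F n in sequentially. \<forall>i\<in>{..k}. fps_nth (f n) i = fps_nth a i"
    using assms(1) by (intro eventually_ball_finite) (auto simp: tendsto_fps_iff)
  moreover have "\<forall>\<^sub>F n in sequentially. \<forall>i\<in>{..k}. fps_nth (g n) i = fps_nth b i"
    using assms(2) by (intro eventually_ball_finite) (auto simp: tendsto_fps_iff)
  ultimately show "\<forall>\<^sub>F n in sequentially. fps_nth (f n * g n) k = fps_nth (a * b) k"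
    by eventually_elim (auto simp: fps_mult_nth intro!: sum.cong)
qed

subsection \<open>Series indexed by lattice points\<close>

text \<open>Stated with sublevel sets so that it passes to sums of exponents: by nonnegativity, a
  sublevel set of the sum lies in the product of two sublevel sets.\<close>

definition admissible :: "'i set \<Rightarrow> ('i \<Rightarrow> int) \<Rightarrow> bool" where
  "admissible I e \<longleftrightarrow> (\<forall>i\<in>I. e i \<ge> 0) \<and> (\<forall>k. finite {i\<in>I. e i \<le> k})"

text \<open>The formal series with terms \<open>w i * q^(e i)\<close>. Sums over infinite sets are 0
  by convention, so this reading needs the finite fibres that \<open>admissible\<close>
  supplies.\<close>

definition gsum :: "'i set \<Rightarrow> ('i \<Rightarrow> int) \<Rightarrow> ('i \<Rightarrow> 'a) \<Rightarrow> 'a :: comm_ring_1 fps" where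
  "gsum I e w = Abs_fps (\<lambda>k. \<Sum>i | i \<in> I \<and> e i = int k. w i)"

lemma gsum_nth: "fps_nth (gsum I e w) k = (\<Sum>i | i \<in> I \<and> e i = int k. w i)"
  by (simp add: gsum_def)

lemma admissible_finite: "admissible I e \<Longrightarrow> finite {i. i \<in> I \<and> e i = k}"
  unfolding admissible_def by (rule finite_subset[of _ "{i\<in>I. e i \<le> k}"]) auto

lemma admissible_subset: "admissible I e \<Longrightarrow> J \<subseteq> I \<Longrightarrow> admissible J e"
  unfolding admissible_def by (blast intro: finite_subset[of "{i\<in>J. e i \<le> _}" "{i\<in>I. e i \<le> _}"])

lemma admissible_Times:
  assumes "admissible I e" "admissible J f"
  shows "admissible (I \<times> J) (\<lambda>(i, j). e i + f j)"
proof -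
  have "finite {x \<in> I \<times> J. (case x of (i, j) \<Rightarrow> e i + f j) \<le> k}" for k
  proof (rule finite_subset)
    show "{x \<in> I \<times> J. (case x of (i, j) \<Rightarrow> e i + f j) \<le> k} \<subseteq> {i\<in>I. e i \<le> k} \<times> {j\<in>J. f j \<le> k}"
      using assms by (fastforce simp: admissible_def)
  qed (use assms in \<open>auto simp: admissible_def\<close>)
  then show ?thesis
    using assms by (auto simp: admissible_def)
qed

lemma gsum_mult:
  assumes "admissible I e" "admissible J f"
  shows "gsum I e w * gsum J f v = gsum (I \<times> J) (\<lambda>(i, j). e i + f j) (\<lambda>(i, j). w i * v j)"
proof (rule fps_ext)
  fix k
  let ?A = "\<lambda>l. {i. i \<in> I \<and> e i = int l}" and ?B = "\<lambda>l. {j. j \<in> J \<and> f j = int l}"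
  \<comment> \<open>Sorting the pairs by the exponent \<open>l\<close> of the first component turns
    the fibre over \<open>k\<close> into the index set of the Cauchy product.\<close>
  have un: "{x. x \<in> I \<times> J \<and> (case x of (i, j) \<Rightarrow> e i + f j) = int k} = (\<Union>l\<in>{0..k}. ?A l \<times> ?B (k - l))"
    (is "?L = ?R")
  proof
    show "?L \<subseteq> ?R"
    proof
      fix x assume "x \<in> ?L"
      then obtain i j where x: "x = (i, j)" "i \<in> I" "j \<in> J" "e i + f j = int k" by auto
      moreover have "e i \<ge> 0" "f j \<ge> 0" using x assms by (auto simp: admissible_def)
      ultimately have "nat (e i) \<in> {0..k}" "i \<in> ?A (nat (e i))" "j \<in> ?B (k - nat (e i))"
        by auto
      then show "x \<in> ?R" using x by blast
    qed
  qed auto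
  have "fps_nth (gsum (I \<times> J) (\<lambda>(i, j). e i + f j) (\<lambda>(i, j). w i * v j)) k =
      (\<Sum>l = 0..k. \<Sum>(i, j)\<in>?A l \<times> ?B (k - l). w i * v j)"
    unfolding gsum_nth un by (rule sum.UNION_disjoint) (use assms in \<open>auto intro!: finite_cartesian_product admissible_finite\<close>)
  also have "\<dots> = fps_nth (gsum I e w * gsum J f v) k"
    by (simp add: fps_mult_nth gsum_nth sum_product sum.cartesian_product)
  finally show "fps_nth (gsum I e w * gsum J f v) k =
      fps_nth (gsum (I \<times> J) (\<lambda>(i, j). e i + f j) (\<lambda>(i, j). w i * v j)) k" by simp
qed

lemma gsum_reindex:
  assumes "bij_betw h I J" "\<And>i. i \<in> I \<Longrightarrow> e' i = e (h i)" "\<And>i. i \<in> I \<Longrightarrow> w' i = w (h i)"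
  shows "gsum J e w = gsum I e' w'"
proof (rule fps_ext)
  fix k
  have "bij_betw h {i. i \<in> I \<and> e' i = int k} {j. j \<in> J \<and> e j = int k}"
    using assms(1,2) by (auto simp: bij_betw_def inj_on_def)
  from sum.reindex_bij_betw[OF this, of w] show "fps_nth (gsum J e w) k = fps_nth (gsum I e' w') k"
    using assms(3) by (simp add: gsum_nth)
qed

lemma gsum_Un:
  assumes "admissible (I \<union> J) e" "I \<inter> J = {}"
  shows "gsum (I \<union> J) e w = gsum I e w + gsum J e w"
proof (rule fps_ext)
  fix k
  have "{i. i \<in> I \<union> J \<and> e i = int k} = {i. i \<in> I \<and> e i = int k} \<union> {i. i \<in> J \<and> e i = int k}"
    by auto
  moreover have "finite {i. i \<in> I \<and> e i = int k}" "finite {i. i \<in> J \<and> e i = int k}"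
    using assms(1) by (auto intro: admissible_finite admissible_subset)
  ultimately show "fps_nth (gsum (I \<union> J) e w) k = fps_nth (gsum I e w + gsum J e w) k"
    using assms(2) by (simp add: gsum_nth) (rule sum.union_disjoint, auto)
qed

lemma gsum_const_mult: "gsum I e (\<lambda>i. c * w i) = fps_const c * gsum I e w"
  by (simp add: fps_eq_iff gsum_nth sum_distrib_left)

lemma gsum_X_mult:
  assumes "admissible I e"
  shows "fps_X * gsum I e w = gsum I (\<lambda>i. e i + 1) w"
proof (rule fps_ext)
  fix k
  show "fps_nth (fps_X * gsum I e w) k = fps_nth (gsum I (\<lambda>i. e i + 1) w) k"
  proof (cases k)
    case 0
    \<comment> \<open>Nonnegative exponents leave the fibre over 0 empty after the shift, matching
      the vanishing constant term on the left.\<close>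
    have "\<forall>i\<in>I. e i + 1 \<noteq> 0"
      using assms by (force simp: admissible_def)
    then show ?thesis using 0 by (auto simp: gsum_nth intro!: sum.neutral)
  qed (simp add: gsum_nth algebra_simps)
qed

lemma fps_compose_fps_X_power_nth:
  fixes f :: "'a :: comm_ring_1 fps"
  assumes "d > 0"
  shows "fps_nth (f oo fps_X ^ d) k = (if d dvd k then fps_nth f (k div d) else 0)"
proof -
  have "fps_nth (f oo fps_X ^ d) k = (\<Sum>i=0..k. if k = d * i then fps_nth f i else 0)"
    by (simp add: fps_compose_nth power_mult [symmetric] if_distrib cong: if_cong)
  also have "\<dots> = (\<Sum>i\<in>{0..k}. if i = k div d then (if d dvd k then fps_nth f i else 0) else 0)"
    using assms by (intro sum.cong) auto
  also have "\<dots> = (if d dvd k then fps_nth f (k div d) else 0)"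
    by (subst sum.delta) auto
  finally show ?thesis .
qed

lemma gsum_compose:
  assumes "d > 0"
  shows "gsum I e w oo fps_X ^ d = gsum I (\<lambda>i. int d * e i) w"
proof (rule fps_ext)
  fix k
  have "{i. i \<in> I \<and> int d * e i = int k} = (if d dvd k then {i. i \<in> I \<and> e i = int (k div d)} else {})"
    using assms by (auto elim!: dvdE simp: zdiv_int) (metis dvd_triv_left int_dvd_int_iff)
  then show "fps_nth (gsum I e w oo fps_X ^ d) k = fps_nth (gsum I (\<lambda>i. int d * e i) w) k"
    using assms by (simp add: fps_compose_fps_X_power_nth gsum_nth)
qed

subsection \<open>The Jacobi triple product\<close>

text \<open>Gaussian binomial coefficients, introduced by a q-Pascal rule so that no division
  occurs.\<close>

fun qbinomial :: "'a :: comm_ring_1 \<Rightarrow> nat \<Rightarrow> nat \<Rightarrow> 'a" where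
  "qbinomial q n 0 = 1"
| "qbinomial q 0 (Suc k) = 0"
| "qbinomial q (Suc n) (Suc k) = qbinomial q n k + q ^ Suc k * qbinomial q n (Suc k)"

text \<open>The finite q-Pochhammer symbol \<open>(q;q)_n\<close>.\<close>

definition qpoch :: "'a :: comm_ring_1 \<Rightarrow> nat \<Rightarrow> 'a" where
  "qpoch q n = (\<Prod>i<n. 1 - q ^ Suc i)"

lemma qpoch_0 [simp]: "qpoch q 0 = 1" and qpoch_Suc: "qpoch q (Suc n) = qpoch q n * (1 - q ^ Suc n)"
  by (simp_all add: qpoch_def)

lemma qbinomial_eq_0: "n < k \<Longrightarrow> qbinomial q n k = 0"
  by (induction q n k rule: qbinomial.induct) auto

lemma qbinomial_self [simp]: "qbinomial q n n = 1"
  by (induction n) (auto simp: qbinomial_eq_0)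

text \<open>The quotient formula for Gaussian binomials with denominators cleared. The induction
  step is the Pascal rule combined with
  \<open>(1 - q^k) + q^k (1 - q^l) = 1 - q^(k + l)\<close>.\<close>

lemma qbinomial_mult_qpoch: "qbinomial q (k + l) k * qpoch q k * qpoch q l = qpoch q (k + l)"
proof (induction "k + l" arbitrary: k l)
  case (Suc n)
  show ?case
  proof (cases k; cases l)
    fix k' l' assume kl: "k = Suc k'" "l = Suc l'"
    have n: "n = k' + l" "n = k + l'" using Suc(2) kl by auto
    have 1: "qbinomial q n k' * qpoch q k' * qpoch q l = qpoch q n"
      and 2: "qbinomial q n k * qpoch q k * qpoch q l' = qpoch q n"
      using Suc(1)[OF n(1)] Suc(1)[OF n(2)] n by simp_all
    have "qbinomial q (k + l) k * qpoch q k * qpoch q l =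
      (qbinomial q n k' * qpoch q k' * qpoch q l) * (1 - q ^ k) +
      q ^ k * (qbinomial q n k * qpoch q k * qpoch q l') * (1 - q ^ l)"
      using Suc(2) kl by (simp add: qpoch_Suc algebra_simps del: power_Suc flip: Suc(2))
    also have "\<dots> = qpoch q n * (1 - q ^ (k + l))"
      unfolding 1 2 by (simp add: algebra_simps power_add)
    also have "\<dots> = qpoch q (k + l)"
      unfolding Suc(2)[symmetric] qpoch_Suc ..
    finally show ?thesis .
  qed (use Suc in \<open>auto simp: Suc(2)\<close>)
qed auto

text \<open>The mirror image of the defining Pascal rule. For \<open>k < n\<close> both sides agree
  after clearing denominators, and \<open>nz\<close> permits the cancellation.\<close>

lemma qbinomial_Suc_Suc':
  fixes q :: "'a :: idom"
  assumes nz: "\<And>n. qpoch q n \<noteq> 0" and "k \<le> n"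
  shows "qbinomial q (Suc n) (Suc k) = q ^ (n - k) * qbinomial q n k + qbinomial q n (Suc k)"
proof (cases "k = n")
  case False
  then obtain l where n: "n = k + Suc l"
    using assms(2) by (metis add_Suc_right le_neq_implies_less less_imp_Suc_add)
  have 1: "qbinomial q n k * qpoch q k * qpoch q (Suc l) = qpoch q n"
    and 2: "qbinomial q n (Suc k) * qpoch q (Suc k) * qpoch q l = qpoch q n"
    and 3: "qbinomial q (Suc n) (Suc k) * qpoch q (Suc k) * qpoch q (Suc l) = qpoch q (Suc n)"
    using qbinomial_mult_qpoch[of q k "Suc l"] qbinomial_mult_qpoch[of q "Suc k" l]
      qbinomial_mult_qpoch[of q "Suc k" "Suc l"] n by simp_all
  have "(q ^ (n - k) * qbinomial q n k + qbinomial q n (Suc k)) * (qpoch q (Suc k) * qpoch q (Suc l)) =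
     q ^ Suc l * (qbinomial q n k * qpoch q k * qpoch q (Suc l)) * (1 - q ^ Suc k) +
     (qbinomial q n (Suc k) * qpoch q (Suc k) * qpoch q l) * (1 - q ^ Suc l)"
    using n by (simp add: qpoch_Suc algebra_simps del: power_Suc)
  also have "\<dots> = qpoch q n * (1 - q ^ Suc n)"
    unfolding 1 2 by (simp add: n algebra_simps power_add)
  also have "\<dots> = qbinomial q (Suc n) (Suc k) * (qpoch q (Suc k) * qpoch q (Suc l))"
    using 3 by (simp add: qpoch_Suc mult.assoc)
  finally show ?thesis
    using nz by (metis mult_cancel_right mult_eq_0_iff)
qed (auto simp: qbinomial_eq_0)

section \<open>Exponents and single terms of theta series\<close>

definition theta_exp :: "nat \<Rightarrow> nat \<Rightarrow> int \<Rightarrow> int" where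
  "theta_exp a b n = int a * (n * (n + 1) div 2) + int b * (n * (n - 1) div 2)"

text \<open>Ramanujan's \<open>f(w q\<^sup>a, w\<^sup>-\<^sup>1 q\<^sup>b)\<close>.\<close>

definition theta :: "nat \<Rightarrow> nat \<Rightarrow> 'a :: field \<Rightarrow> 'a fps" where
  "theta a b w = gsum UNIV (theta_exp a b) (\<lambda>n. w powi n)"

lemma two_theta_exp: "2 * theta_exp a b n = int a * (n * (n + 1)) + int b * (n * (n - 1))"
proof -
  have "2 * (n * (n + 1) div 2) = n * (n + 1)" "2 * (n * (n - 1) div 2) = n * (n - 1)"
    by (intro dvd_mult_div_cancel; simp)+
  then show ?thesis unfolding theta_exp_def by (metis distrib_left mult.left_commute)
qed

text \<open>At least one of \<open>a\<close>, \<open>b\<close> is positive, which leaves a quadratic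
  lower bound for the exponent. The weaker linear form suffices for finite sublevel sets and for
  locating the indices that reach a given coefficient.\<close>

lemma theta_exp_bound:
  assumes "a + b > 0"
  shows "\<bar>n\<bar> \<le> theta_exp a b n + 1"
proof -
  have "n * (n + 1) \<ge> 0" "n * (n - 1) \<ge> 0"
    by (auto simp: zero_le_mult_iff)
  moreover have "int a \<ge> 1 \<or> int b \<ge> 1" using assms by linarith
  ultimately have "n * (n + 1) \<le> 2 * theta_exp a b n \<or> n * (n - 1) \<le> 2 * theta_exp a b n"
    unfolding two_theta_exp
    by (smt (verit, best) mult_le_cancel_right1 of_nat_0_le_iff zero_le_mult_iff)
  moreover have "2 * \<bar>n\<bar> - 2 \<le> n * (n + 1)" "2 * \<bar>n\<bar> - 2 \<le> n * (n - 1)"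
  proof -
    \<comment> \<open>Two consecutive integers never have a negative product.\<close>
    have "(\<bar>n\<bar> - 1) * (\<bar>n\<bar> - 2) \<ge> 0" by (auto simp: zero_le_mult_iff)
    then have "n * n + 2 \<ge> 3 * \<bar>n\<bar>" by (simp add: algebra_simps)
    then show "2 * \<bar>n\<bar> - 2 \<le> n * (n + 1)" "2 * \<bar>n\<bar> - 2 \<le> n * (n - 1)"
      by (auto simp: algebra_simps abs_if split: if_splits)
  qed
  ultimately show ?thesis by linarith
qed

lemma theta_exp_nonneg: "theta_exp a b n \<ge> 0"
proof -
  have "n * (n + 1) \<ge> 0" "n * (n - 1) \<ge> 0"
    by (auto simp: zero_le_mult_iff)
  then show ?thesis unfolding theta_exp_def by (auto simp: pos_imp_zdiv_nonneg_iff)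
qed

lemma admissible_theta_exp: "a + b > 0 \<Longrightarrow> admissible UNIV (theta_exp a b)"
  unfolding admissible_def
proof (intro conjI allI ballI theta_exp_nonneg)
  fix k assume *: "a + b > 0"
  show "finite {n \<in> UNIV. theta_exp a b n \<le> k}"
    by (rule finite_subset[of _ "{- k - 1..k + 1}"]) (auto, (use theta_exp_bound[OF *] in \<open>smt (verit)\<close>)+)
qed

lemma theta_exp_Suc: "theta_exp a b (n + 1) = theta_exp a b n + int a + int (a + b) * n"
proof -
  have "2 * theta_exp a b (n + 1) = 2 * (theta_exp a b n + int a + int (a + b) * n)"
    unfolding distrib_left two_theta_exp by (simp add: algebra_simps)
  then show ?thesis by simp
qed

lemma qpoch_fps_X_nth_0:
  assumes "s > 0"
  shows "fps_nth (qpoch (fps_X ^ s) n :: 'a :: comm_ring_1 fps) 0 = 1"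
  using assms by (induction n) (auto simp: qpoch_Suc simp flip: power_mult power_Suc)

lemma qpoch_fps_X_nonzero:
  assumes "s > 0"
  shows "(qpoch (fps_X ^ s) n :: 'a :: idom fps) \<noteq> 0"
  using qpoch_fps_X_nth_0[OF assms, of n, where 'a = 'a] by (metis fps_zero_nth zero_neq_one)

definition theta_term :: "nat \<Rightarrow> nat \<Rightarrow> 'a :: field \<Rightarrow> int \<Rightarrow> 'a fps" where
  "theta_term a b w n = fps_const (w powi n) * fps_X ^ nat (theta_exp a b n)"

text \<open>Multiplication by the next factor's monomial raises the index by one. The surplus power
  of \<open>fps_X ^ (a + b)\<close> is exactly the weight in
  \<open>qbinomial_Suc_Suc'\<close>.\<close>

lemma theta_term_step_up:
  fixes w :: "'a :: field"
  assumes "w \<noteq> 0" "k \<le> M"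
  shows "theta_term a b w (int k) * (fps_const w * fps_X ^ (a + (a + b) * M)) =
    (fps_X ^ (a + b)) ^ (M - k) * theta_term a b w (int (Suc k))"
proof -
  obtain d where "M = k + d"
    using assms(2) by (metis le_Suc_ex)
  then have "int (nat (theta_exp a b (int k)) + (a + (a + b) * M)) =
      int ((a + b) * (M - k) + nat (theta_exp a b (int (Suc k))))"
    using theta_exp_Suc[of a b "int k"] theta_exp_nonneg[of a b]
    by (simp add: algebra_simps)
  then have "nat (theta_exp a b (int k)) + (a + (a + b) * M) =
      (a + b) * (M - k) + nat (theta_exp a b (int (Suc k)))"
    by (simp only: of_nat_eq_iff)
  moreover have "w powi int k * w = w powi int (Suc k)"
    by (simp only: power_int_of_nat power_Suc2)
  ultimately have "fps_const (w powi int k * w) * fps_X ^ (nat (theta_exp a b (int k)) + (a + (a + b) * M)) =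
      fps_const (w powi int (Suc k)) * (fps_X ^ ((a + b) * (M - k) + nat (theta_exp a b (int (Suc k)))) :: 'a fps)"
    by (simp only:)
  \<comment> \<open>An opaque name for \<open>a + b\<close> keeps \<open>power_add\<close> from
    splitting the base \<open>fps_X ^ (a + b)\<close>.\<close>
  moreover define s where "s = a + b"
  ultimately show ?thesis
    unfolding theta_term_def s_def[symmetric]
    by (simp only: power_add power_mult[symmetric] fps_const_mult[symmetric] ac_simps)
qed

text \<open>The counterpart for the factors with \<open>inverse w\<close>: the index drops by one,
  and the surplus fits the defining Pascal rule of \<open>qbinomial\<close>.\<close>

lemma theta_term_step_down:
  fixes w :: "'a :: field"
  assumes "w \<noteq> 0"
  shows "theta_term a b w (int k - int N) * (fps_const (inverse w) * fps_X ^ (b + (a + b) * N)) =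
    (fps_X ^ (a + b)) ^ k * theta_term a b w (int k - int (Suc N))"
proof -
  have "int (nat (theta_exp a b (int k - int N)) + (b + (a + b) * N)) =
      int ((a + b) * k + nat (theta_exp a b (int k - int (Suc N))))"
    using theta_exp_Suc[of a b "int k - int (Suc N)"] theta_exp_nonneg[of a b]
    by (simp add: algebra_simps)
  then have "nat (theta_exp a b (int k - int N)) + (b + (a + b) * N) =
      (a + b) * k + nat (theta_exp a b (int k - int (Suc N)))"
    by (simp only: of_nat_eq_iff)
  moreover have "w powi (int k - int N) * inverse w = w powi (int k - int (Suc N))"
    using assms power_int_add_1[of w "int k - int (Suc N)"] by simp
  ultimately have "fps_const (w powi (int k - int N) * inverse w) * fps_X ^ (nat (theta_exp a b (int k - int N)) + (b + (a + b) * N)) =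
      fps_const (w powi (int k - int (Suc N))) * (fps_X ^ ((a + b) * k + nat (theta_exp a b (int k - int (Suc N)))) :: 'a fps)"
    by (simp only:)
  moreover define s where "s = a + b"
  ultimately show ?thesis
    unfolding theta_term_def s_def[symmetric]
    by (simp only: power_add power_mult[symmetric] fps_const_mult[symmetric] ac_simps)
qed

text \<open>A form of the q-binomial theorem. The factor added in the induction shifts the sum by
  one index, and the mirrored Pascal rule merges the two copies.\<close>

lemma finite_jacobi_triple_product_right:
  assumes "w \<noteq> 0" "a + b > 0"
  shows "(\<Prod>i<M. 1 + fps_const w * fps_X ^ (a + (a + b) * i)) =
    (\<Sum>k\<le>M. qbinomial (fps_X ^ (a + b)) M k * theta_term a b w (int k))"
proof (induction M)
  case (Suc M)
  let ?q = "fps_X ^ (a + b) :: 'a fps" and ?t = "\<lambda>k. theta_term a b w (int k)"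
  have "(\<Prod>i<Suc M. 1 + fps_const w * fps_X ^ (a + (a + b) * i)) =
     (\<Sum>k\<le>M. qbinomial ?q M k * ?t k) +
     (\<Sum>k\<le>M. qbinomial ?q M k * (?t k * (fps_const w * fps_X ^ (a + (a + b) * M))))"
    by (simp add: Suc distrib_left sum_distrib_right mult.assoc)
  \<comment> \<open>The added term \<open>k = Suc M\<close> is zero; with it, splitting off
    \<open>k = 0\<close> leaves a sum over the same range as the shifted copy.\<close>
  also have "(\<Sum>k\<le>M. qbinomial ?q M k * ?t k) = (\<Sum>k\<le>Suc M. qbinomial ?q M k * ?t k)"
    by (simp add: qbinomial_eq_0)
  also have "\<dots> = ?t 0 + (\<Sum>k\<le>M. qbinomial ?q M (Suc k) * ?t (Suc k))"
    by (subst sum.atMost_Suc_shift) simp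
  also have "(\<Sum>k\<le>M. qbinomial ?q M k * (?t k * (fps_const w * fps_X ^ (a + (a + b) * M)))) =
      (\<Sum>k\<le>M. qbinomial ?q M k * (?q ^ (M - k) * ?t (Suc k)))"
    using assms by (intro sum.cong refl arg_cong2[where f = "(*)"] theta_term_step_up) auto
  also have "?t 0 + (\<Sum>k\<le>M. qbinomial ?q M (Suc k) * ?t (Suc k)) + \<dots> =
      ?t 0 + (\<Sum>k\<le>M. qbinomial ?q (Suc M) (Suc k) * ?t (Suc k))"
    unfolding add.assoc sum.distrib[symmetric] using assms(2)
    by (intro arg_cong2[where f = "(+)"] sum.cong refl,
        subst qbinomial_Suc_Suc'[OF qpoch_fps_X_nonzero])
       (auto simp: algebra_simps)
  also have "\<dots> = (\<Sum>k\<le>Suc M. qbinomial ?q (Suc M) k * ?t k)"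
    by (subst sum.atMost_Suc_shift) simp
  finally show ?case .
qed (simp add: theta_term_def theta_exp_def)

text \<open>Induction on \<open>N\<close> from the one-sided case. Each new factor with
  \<open>inverse w\<close> moves the window of indices down by one, and this time the defining
  Pascal rule merges the copies.\<close>

lemma finite_jacobi_triple_product:
  assumes "w \<noteq> 0" "a + b > 0"
  shows "(\<Prod>i<M. 1 + fps_const w * fps_X ^ (a + (a + b) * i)) *
      (\<Prod>i<N. 1 + fps_const (inverse w) * fps_X ^ (b + (a + b) * i)) =
    (\<Sum>k\<le>M + N. qbinomial (fps_X ^ (a + b)) (M + N) k * theta_term a b w (int k - int N))"
proof (induction N)
  case 0
  then show ?case using finite_jacobi_triple_product_right[OF assms] by simp
next
  case (Suc N)
  let ?q = "fps_X ^ (a + b) :: 'a fps" and ?t = "\<lambda>N k. theta_term a b w (int k - int N)"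
  let ?K = "M + N"
  have "(\<Prod>i<M. 1 + fps_const w * fps_X ^ (a + (a + b) * i)) *
      (\<Prod>i<Suc N. 1 + fps_const (inverse w) * fps_X ^ (b + (a + b) * i)) =
     (\<Sum>k\<le>?K. qbinomial ?q ?K k * ?t N k) +
     (\<Sum>k\<le>?K. qbinomial ?q ?K k * (?t N k * (fps_const (inverse w) * fps_X ^ (b + (a + b) * N))))"
    by (simp add: Suc[symmetric] distrib_left sum_distrib_right[symmetric] mult.assoc[symmetric])
  also have "(\<Sum>k\<le>?K. qbinomial ?q ?K k * (?t N k * (fps_const (inverse w) * fps_X ^ (b + (a + b) * N)))) =
      (\<Sum>k\<le>?K. qbinomial ?q ?K k * (?q ^ k * ?t (Suc N) k))"
    using assms by (intro sum.cong refl arg_cong2[where f = "(*)"] theta_term_step_down) auto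
  also have "\<dots> = (\<Sum>k\<le>Suc ?K. qbinomial ?q ?K k * (?q ^ k * ?t (Suc N) k))"
    by (simp add: qbinomial_eq_0)
  also have "\<dots> = ?t (Suc N) 0 + (\<Sum>k\<le>?K. qbinomial ?q ?K (Suc k) * (?q ^ Suc k * ?t (Suc N) (Suc k)))"
    by (subst sum.atMost_Suc_shift) simp
  also have "(\<Sum>k\<le>?K. qbinomial ?q ?K k * ?t N k) + \<dots> =
      ?t (Suc N) 0 + (\<Sum>k\<le>?K. qbinomial ?q (Suc ?K) (Suc k) * ?t (Suc N) (Suc k))"
    by (subst add.left_commute, subst sum.distrib[symmetric])
       (auto simp: algebra_simps intro!: sum.cong)
  also have "\<dots> = (\<Sum>k\<le>Suc ?K. qbinomial ?q (Suc ?K) k * ?t (Suc N) k)"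
    by (subst sum.atMost_Suc_shift) simp
  finally show ?case by simp
qed

text \<open>The factors beyond the \<open>n\<close>-th are congruent to 1 modulo
  \<open>fps_X ^ Suc n\<close>.\<close>

lemma qpoch_fps_X_cong:
  assumes "s > 0" "n \<le> j"
  shows "(fps_X :: 'a :: comm_ring_1 fps) ^ Suc n dvd qpoch (fps_X ^ s) j - qpoch (fps_X ^ s) n"
  using assms(2)
proof (induction j rule: dec_induct)
  case (step j)
  have "Suc n \<le> s * Suc j"
    using step(1) assms(1) by (metis Suc_le_mono le_trans mult_le_mono nat_mult_1 Suc_leI One_nat_def)
  then have "(fps_X :: 'a fps) ^ Suc n dvd qpoch (fps_X ^ s) j * (fps_X ^ s) ^ Suc j"
    by (metis dvd_mult le_imp_power_dvd power_mult)
  moreover have "qpoch (fps_X ^ s) (Suc j) - qpoch (fps_X ^ s) n =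
      (qpoch (fps_X ^ s) j - qpoch (fps_X ^ s) n) - qpoch (fps_X ^ s) j * (fps_X ^ s :: 'a fps) ^ Suc j"
    by (simp add: qpoch_Suc algebra_simps)
  ultimately show ?case using step.IH by (metis dvd_diff)
qed auto

text \<open>Modulo \<open>fps_X ^ Suc n\<close> all the Pochhammer symbols involved equal
  \<open>u\<close>, so the product formula reads \<open>c * u * u = u\<close>. Since
  \<open>u\<close> has constant term 1 it is a unit, whence \<open>c * u = 1\<close>.\<close>

lemma qbinomial_mult_qpoch_cong:
  assumes "s > 0" "n \<le> k" "n \<le> l" "n \<le> m"
  shows "(fps_X :: 'a :: field fps) ^ Suc n dvd qbinomial (fps_X ^ s) (k + l) k * qpoch (fps_X ^ s) m - 1"
proof -
  let ?q = "fps_X ^ s :: 'a fps"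
  define u where "u = qpoch ?q n"
  define c where "c = qbinomial ?q (k + l) k"
  have *: "\<exists>r. qpoch ?q j = u + fps_X ^ Suc n * r" if "n \<le> j" for j
    using qpoch_fps_X_cong[OF assms(1) that, where 'a = 'a] unfolding u_def
    by (metis dvdE add.commute diff_add_cancel)
  obtain r1 r2 r3 r4 where r: "qpoch ?q k = u + fps_X ^ Suc n * r1" "qpoch ?q l = u + fps_X ^ Suc n * r2"
      "qpoch ?q m = u + fps_X ^ Suc n * r3" "qpoch ?q (k + l) = u + fps_X ^ Suc n * r4"
    using * assms by (metis trans_le_add1)
  define x where "x = (fps_X ^ Suc n :: 'a fps)"
  note r = r[folded x_def]
  have *: "c * (u + x * r1) * (u + x * r2) = u + x * r4"
    using qbinomial_mult_qpoch[of ?q k l] unfolding r c_def[symmetric] .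
  \<comment> \<open>Multiplying by the unit \<open>u * u\<close> does not affect divisibility by
    \<open>x\<close> and makes the product formula applicable.\<close>
  have "u * u * (c * (u + x * r3) - 1) = (c * (u + x * r1) * (u + x * r2)) * (u + x * r3) - u * u
      - x * (c * (u + x * r3) * (r1 * u + u * r2 + x * r1 * r2))"
    by (simp add: algebra_simps)
  also have "\<dots> = x * (r4 * (u + x * r3) + u * r3 - c * (u + x * r3) * (r1 * u + u * r2 + x * r1 * r2))"
    unfolding * by (simp add: algebra_simps)
  finally have "x dvd u * u * (c * (u + x * r3) - 1)"
    by simp
  moreover have "is_unit (u * u)"
    using qpoch_fps_X_nth_0[OF assms(1), of n, where 'a = 'a] by (simp add: u_def)
  ultimately have "x dvd c * (u + x * r3) - 1"
    by (simp add: dvd_mult_unit_iff mult.commute[of "u * u"])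
  then show ?thesis unfolding c_def r x_def[symmetric] .
qed

theorem jacobi_triple_product:
  fixes w :: "'a :: field"
  assumes "w \<noteq> 0" "a + b > 0"
  shows "(\<lambda>N. (\<Prod>i<N. 1 + fps_const w * fps_X ^ (a + (a + b) * i)) *
      (\<Prod>i<N. 1 + fps_const (inverse w) * fps_X ^ (b + (a + b) * i)) *
      qpoch (fps_X ^ (a + b)) N) \<longlonglongrightarrow> theta a b w"
    (is "?P \<longlonglongrightarrow> _")
proof (rule tendsto_fpsI, rule eventually_sequentiallyI)
  \<comment> \<open>Only indices with \<open>\<bar>k - N\<bar> \<le> n + 1\<close> reach coefficient
    \<open>n\<close>. For these the bound \<open>2 * n + 1 \<le> N\<close> makes \<open>k\<close>,
    \<open>N + N - k\<close> and \<open>N\<close> all at least \<open>n\<close>, as the congruence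
    requires.\<close>
  fix n N :: nat assume N: "2 * n + 1 \<le> N"
  let ?q = "fps_X ^ (a + b) :: 'a fps" and ?t = "\<lambda>k. theta_term a b w (int k - int N)"
  have t_nth: "fps_nth (theta_term a b w j) i = (if theta_exp a b j = int i then w powi j else 0)" for i j
    using theta_exp_nonneg[of a b j] by (auto simp: theta_term_def)
  have summand: "fps_nth (qbinomial ?q (N + N) k * ?t k * qpoch ?q N) n = fps_nth (?t k) n"
    if k: "k \<le> N + N" for k
  proof (cases "theta_exp a b (int k - int N) \<le> int n")
    case True
    then have "\<bar>int k - int N\<bar> \<le> int n + 1"
      using theta_exp_bound[OF assms(2), of "int k - int N"] by linarith
    then have "n \<le> k" "n \<le> N + N - k" "n \<le> N"
      using N by linarith+
    from qbinomial_mult_qpoch_cong[OF assms(2) this, where 'a = 'a] k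
    obtain r where "qbinomial ?q (N + N) k * qpoch ?q N = 1 + fps_X ^ Suc n * r"
      by (metis dvdE add.commute diff_add_cancel le_add_diff_inverse)
    then have "qbinomial ?q (N + N) k * ?t k * qpoch ?q N = ?t k + fps_X ^ Suc n * (r * ?t k)"
      by (simp add: mult.commute[of _ "?t k"] mult.assoc distrib_left mult.left_commute[of _ "?t k"] del: power_Suc)
    then show ?thesis
      by (simp add: fps_X_power_mult_nth del: power_Suc)
  next
    case False
    have "fps_nth (?t k) i = 0" if "i \<le> n" for i
      using False that by (simp add: t_nth)
    then show ?thesis
      by (simp add: fps_mult_nth)
  qed
  have "fps_nth (?P N) n = (\<Sum>k\<le>N + N. fps_nth (?t k) n)"
    unfolding finite_jacobi_triple_product[OF assms] sum_distrib_right fps_sum_nth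
    by (intro sum.cong refl summand) auto
  also have "\<dots> = (\<Sum>j\<in>{- int N..int N}. fps_nth (theta_term a b w j) n)"
    by (rule sum.reindex_bij_witness[of _ "\<lambda>j. nat (j + int N)" "\<lambda>k. int k - int N"]) auto
  also have "\<dots> = (\<Sum>j | theta_exp a b j = int n. fps_nth (theta_term a b w j) n)"
  proof (rule sum.mono_neutral_right)
    show "{j. theta_exp a b j = int n} \<subseteq> {- int N..int N}"
    proof
      fix j assume "j \<in> {j. theta_exp a b j = int n}"
      then show "j \<in> {- int N..int N}"
        using theta_exp_bound[OF assms(2), of j] N by auto
    qed
  qed (auto simp: t_nth)
  also have "\<dots> = fps_nth (theta a b w) n"
    by (simp add: theta_def gsum_nth t_nth)
  finally show "fps_nth (?P N) n = fps_nth (theta a b w) n" .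
qed

subsection \<open>Product evaluations of theta series\<close>

lemma tendsto_compose_fps_X_power:
  fixes F :: "'a :: comm_ring_1 fps"
  assumes "f \<longlonglongrightarrow> F" "d > 0"
  shows "(\<lambda>n. f n oo fps_X ^ d) \<longlonglongrightarrow> (F oo fps_X ^ d)"
proof (rule tendsto_fpsI)
  fix k
  have "\<forall>\<^sub>F n in sequentially. fps_nth (f n) (k div d) = fps_nth F (k div d)"
    using assms(1) by (simp add: tendsto_fps_iff)
  then show "\<forall>\<^sub>F n in sequentially. fps_nth (f n oo fps_X ^ d) k = fps_nth (F oo fps_X ^ d) k"
    by eventually_elim (simp add: fps_compose_fps_X_power_nth assms(2))
qed

lemma qpoch_compose:
  assumes "d > 0"
  shows "qpoch (fps_X ^ m) n oo fps_X ^ d = (qpoch (fps_X ^ (d * m)) n :: 'a :: idom fps)"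
proof -
  have "fps_nth (fps_X ^ d :: 'a fps) 0 = 0" using assms by simp
  then show ?thesis
    by (simp add: qpoch_def fps_compose_prod_distrib fps_compose_sub_distrib fps_X_power_compose
          algebra_simps flip: power_mult power_Suc)
qed

lemma qpoch_tendsto_euler_f:
  assumes "m \<ge> 1"
  shows "(\<lambda>N. qpoch (fps_X ^ m) N) \<longlonglongrightarrow> euler_f m"
  using has_prod_imp_tendsto'[OF euler_f_has_prod(1)[OF assms]]
  by (simp add: qpoch_def flip: power_mult power_Suc)

lemma euler_f_compose:
  assumes "m \<ge> 1" "d \<ge> 1"
  shows "euler_f m oo fps_X ^ d = euler_f (d * m)"
proof -
  have "(\<lambda>N. qpoch (fps_X ^ (d * m)) N) \<longlonglongrightarrow> (euler_f m oo fps_X ^ d)"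
    using tendsto_compose_fps_X_power[OF qpoch_tendsto_euler_f[OF assms(1)], of d] assms(2)
    by (simp add: qpoch_compose)
  moreover have "(\<lambda>N. qpoch (fps_X ^ (d * m)) N) \<longlonglongrightarrow> euler_f (d * m)"
    using assms by (intro qpoch_tendsto_euler_f) simp
  ultimately show ?thesis by (rule LIMSEQ_unique)
qed

text \<open>The theta argument needs a primitive cube root of unity. This embedding is an injective
  ring homomorphism, so the final identity can be pulled back to rational coefficients.\<close>

definition complex_fps :: "rat fps \<Rightarrow> complex fps" where
  "complex_fps f = Abs_fps (\<lambda>n. of_rat (fps_nth f n))"

lemma complex_fps_nth [simp]: "fps_nth (complex_fps f) n = of_rat (fps_nth f n)"
  by (simp add: complex_fps_def)

lemma complex_fps_eq_iff: "complex_fps f = complex_fps g \<longleftrightarrow> f = g"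
  by (simp add: fps_eq_iff)

lemma complex_fps_simps:
  "complex_fps (f + g) = complex_fps f + complex_fps g"
  "complex_fps (f - g) = complex_fps f - complex_fps g"
  "complex_fps (f * g) = complex_fps f * complex_fps g"
  "complex_fps 1 = 1" "complex_fps fps_X = fps_X"
  by (auto simp: fps_eq_iff of_rat_add of_rat_diff fps_mult_nth of_rat_sum of_rat_mult)

lemma complex_fps_power: "complex_fps (f ^ n) = complex_fps f ^ n"
  by (induction n) (simp_all add: complex_fps_simps)

lemma complex_fps_compose:
  "d > 0 \<Longrightarrow> complex_fps (f oo fps_X ^ d) = complex_fps f oo fps_X ^ d"
  by (simp add: fps_eq_iff fps_compose_fps_X_power_nth)

lemma complex_fps_qpoch: "complex_fps (qpoch q n) = qpoch (complex_fps q) n"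
  by (induction n) (simp_all only: qpoch_0 qpoch_Suc complex_fps_simps complex_fps_power)

text \<open>The multiple \<open>c\<close> is there because sorting exponents by residues produces
  truncations of lengths such as \<open>2 * N\<close> or \<open>3 * N\<close>.\<close>

lemma qpoch_tendsto_complex_euler_f:
  assumes "m \<ge> 1" "c \<ge> 1"
  shows "(\<lambda>N. qpoch (fps_X ^ m) (c * N)) \<longlonglongrightarrow> complex_fps (euler_f m)"
proof -
  have "(\<lambda>N. complex_fps (qpoch (fps_X ^ m) N)) \<longlonglongrightarrow> complex_fps (euler_f m)"
    using qpoch_tendsto_euler_f[OF assms(1)] unfolding tendsto_fps_iff
    by (auto elim: eventually_mono)
  then have "(\<lambda>N. qpoch (fps_X ^ m) N) \<longlonglongrightarrow> complex_fps (euler_f m)"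
    by (simp add: complex_fps_qpoch complex_fps_power complex_fps_simps)
  moreover have "filterlim (\<lambda>N. c * N) sequentially sequentially"
    using assms(2) by (intro filterlim_subseq) (simp add: strict_mono_def)
  ultimately show ?thesis by (rule filterlim_compose)
qed

lemma qpoch_tendsto_complex_euler_f_1:
  "m \<ge> 1 \<Longrightarrow> (\<lambda>N. qpoch (fps_X ^ m) N) \<longlonglongrightarrow> complex_fps (euler_f m)"
  using qpoch_tendsto_complex_euler_f[of m 1] by simp

lemma complex_euler_f_nonzero: "m \<ge> 1 \<Longrightarrow> complex_fps (euler_f m) \<noteq> 0"
  using euler_f_has_prod(2)[of m] by (metis complex_fps_nth fps_zero_nth of_rat_1 zero_neq_one)

section \<open>The finite products \<open>(-q;q)_n\<close> and \<open>(-q;q^2)_n\<close>\<close>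

definition ppoch :: "'a :: comm_ring_1 \<Rightarrow> nat \<Rightarrow> 'a" where
  "ppoch q n = (\<Prod>i<n. 1 + q ^ Suc i)"

definition opoch :: "'a :: comm_ring_1 \<Rightarrow> nat \<Rightarrow> 'a" where
  "opoch q n = (\<Prod>i<n. 1 + q ^ (2 * i + 1))"

lemma ppoch_mult_qpoch: "ppoch q n * qpoch q n = qpoch (q ^ 2) n"
  unfolding ppoch_def qpoch_def prod.distrib[symmetric]
  by (intro prod.cong refl) (simp add: algebra_simps power2_eq_square power_mult_distrib)

lemma ppoch_0 [simp]: "ppoch q 0 = 1" and ppoch_Suc: "ppoch q (Suc n) = ppoch q n * (1 + q ^ Suc n)"
  by (simp_all add: ppoch_def)

lemma opoch_0 [simp]: "opoch q 0 = 1" and opoch_Suc: "opoch q (Suc n) = opoch q n * (1 + q ^ (2 * n + 1))"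
  by (simp_all add: opoch_def)

lemma opoch_mult_ppoch: "opoch q n * ppoch (q ^ 2) n = ppoch q (2 * n)"
proof (induction n)
  case (Suc n)
  have e: "2 * Suc n = Suc (Suc (2 * n))" "2 * n + 1 = Suc (2 * n)" by simp_all
  have "opoch q (Suc n) * ppoch (q ^ 2) (Suc n) =
      (opoch q n * ppoch (q ^ 2) n) * (1 + q ^ (2 * n + 1)) * (1 + q ^ (2 * Suc n))"
    by (simp only: opoch_Suc ppoch_Suc power_mult[symmetric] mult_ac)
  also have "\<dots> = ppoch q (2 * Suc n)"
    unfolding Suc e ppoch_Suc ..
  finally show ?case .
qed simp

text \<open>The finite, division-free form of \<open>(-q;q^2) = f_2^2 / (f_1 f_4)\<close> for the
  infinite products.\<close>

lemma opoch_mult_qpoch: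
  "opoch q n * (qpoch (q ^ 4) n * qpoch q (2 * n)) = qpoch (q ^ 2) (2 * n) * qpoch (q ^ 2) n"
proof -
  have "qpoch (q ^ 4) n = ppoch (q ^ 2) n * qpoch (q ^ 2) n"
    by (simp add: ppoch_mult_qpoch flip: power_mult)
  then have "opoch q n * (qpoch (q ^ 4) n * qpoch q (2 * n)) =
      (opoch q n * ppoch (q ^ 2) n) * qpoch q (2 * n) * qpoch (q ^ 2) n"
    by (simp add: mult_ac)
  then show ?thesis
    by (simp add: opoch_mult_ppoch ppoch_mult_qpoch)
qed

text \<open>The exponents up to \<open>3 * n\<close> are sorted by residue modulo 3. The next two
  lemmas do the same for odd exponents modulo 6 and modulo 4.\<close>

lemma prod_third_mult_ppoch:
  "(\<Prod>i<n. 1 + q ^ (2 + 3 * i)) * (\<Prod>i<n. 1 + q ^ (1 + 3 * i)) * ppoch (q ^ 3) n = ppoch q (3 * n)"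
    (is "?P n * ?Q n * _ = _")
proof (induction n)
  case (Suc n)
  have e: "3 * Suc n = Suc (Suc (Suc (3 * n)))" "2 + 3 * n = Suc (Suc (3 * n))" "1 + 3 * n = Suc (3 * n)"
    by simp_all
  have "?P (Suc n) * ?Q (Suc n) * ppoch (q ^ 3) (Suc n) =
      (?P n * ?Q n * ppoch (q ^ 3) n) * (1 + q ^ (1 + 3 * n)) * (1 + q ^ (2 + 3 * n)) * (1 + q ^ (3 * Suc n))"
    by (simp only: prod.lessThan_Suc ppoch_Suc power_mult[symmetric] mult_ac)
  also have "\<dots> = ppoch q (3 * Suc n)"
    unfolding Suc e ppoch_Suc ..
  finally show ?case .
qed simp

lemma prod_sixth_mult_opoch:
  "(\<Prod>i<n. 1 + q ^ (5 + 6 * i)) * (\<Prod>i<n. 1 + q ^ (1 + 6 * i)) * opoch (q ^ 3) n = opoch q (3 * n)"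
    (is "?P n * ?Q n * _ = _")
proof (induction n)
  case (Suc n)
  have e: "3 * Suc n = Suc (Suc (Suc (3 * n)))" "5 + 6 * n = 2 * Suc (Suc (3 * n)) + 1"
    "1 + 6 * n = 2 * (3 * n) + 1" "3 * (2 * n + 1) = 2 * Suc (3 * n) + 1"
    by simp_all
  have "?P (Suc n) * ?Q (Suc n) * opoch (q ^ 3) (Suc n) =
      (?P n * ?Q n * opoch (q ^ 3) n) * (1 + q ^ (1 + 6 * n)) * (1 + q ^ (3 * (2 * n + 1))) * (1 + q ^ (5 + 6 * n))"
    by (simp only: prod.lessThan_Suc opoch_Suc power_mult[symmetric] mult_ac)
  also have "\<dots> = opoch q (3 * Suc n)"
    unfolding Suc e opoch_Suc ..
  finally show ?case .
qed simp

lemma prod_fourth_opoch: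
  "(\<Prod>i<n. 1 + q ^ (3 + 4 * i)) * (\<Prod>i<n. 1 + q ^ (1 + 4 * i)) = opoch q (2 * n)"
    (is "?P n * ?Q n = _")
proof (induction n)
  case (Suc n)
  have e: "2 * Suc n = Suc (Suc (2 * n))" "3 + 4 * n = 2 * Suc (2 * n) + 1" "1 + 4 * n = 2 * (2 * n) + 1"
    by simp_all
  have "?P (Suc n) * ?Q (Suc n) = (?P n * ?Q n) * (1 + q ^ (1 + 4 * n)) * (1 + q ^ (3 + 4 * n))"
    by (simp only: prod.lessThan_Suc mult_ac)
  also have "\<dots> = opoch q (2 * Suc n)"
    unfolding Suc e opoch_Suc ..
  finally show ?case .
qed simp

abbreviation ef :: "nat \<Rightarrow> complex fps" where
  "ef m \<equiv> complex_fps (euler_f m)"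

text \<open>The case \<open>w = 1\<close> with a common factor of both parameters moved into the
  base, the shape to which the residue lemmas apply.\<close>

lemma jacobi_triple_product_1:
  fixes a b c :: nat
  assumes "c * (a + b) > 0"
  defines "q \<equiv> fps_X ^ c :: 'a :: field fps"
  shows "(\<lambda>N. (\<Prod>i<N. 1 + q ^ (a + (a + b) * i)) * (\<Prod>i<N. 1 + q ^ (b + (a + b) * i)) * qpoch (q ^ (a + b)) N)
    \<longlonglongrightarrow> theta (c * a) (c * b) 1"
proof -
  have "c * a + (c * a + c * b) * i = c * (a + (a + b) * i)" "c * b + (c * a + c * b) * i = c * (b + (a + b) * i)"
    "c * a + c * b = c * (a + b)" for i
    by (simp_all add: algebra_simps)
  then show ?thesis
    using jacobi_triple_product[of "1 :: 'a" "c * a" "c * b"] assms(1)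
    by (simp add: q_def flip: power_mult)
qed

text \<open>For \<open>b = 0\<close> the second product starts with the constant
  \<open>1 + inverse w\<close>. Pulling it out shifts the remaining factors, at the cost of one
  extra factor \<open>?r N\<close> that tends to 1.\<close>

lemma jacobi_triple_product_0:
  fixes w :: "'a :: field"
  assumes "w \<noteq> 0" "s > 0"
  shows "(\<lambda>N. fps_const (1 + inverse w) * ((\<Prod>i<N. 1 + fps_const w * (fps_X ^ s) ^ Suc i) *
      (\<Prod>i<N. 1 + fps_const (inverse w) * (fps_X ^ s) ^ Suc i) * qpoch (fps_X ^ s) N)) \<longlonglongrightarrow> theta s 0 w"
proof -
  let ?A = "\<lambda>N. \<Prod>i<N. 1 + fps_const w * (fps_X ^ s) ^ Suc i"
    and ?B = "\<lambda>N. \<Prod>i<N. 1 + fps_const (inverse w) * (fps_X ^ s) ^ i"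
    and ?C = "\<lambda>N. \<Prod>i<N. 1 + fps_const (inverse w) * (fps_X ^ s) ^ Suc i"
    and ?q = "\<lambda>N. qpoch (fps_X ^ s :: 'a fps) N"
    and ?r = "\<lambda>N. 1 + fps_const (inverse w) * (fps_X ^ s) ^ N"
  have "(\<lambda>N. ?A N * ?B N * ?q N) \<longlonglongrightarrow> theta s 0 w"
    using jacobi_triple_product[of w s 0] assms by (simp flip: power_mult power_add)
  moreover have "?r \<longlonglongrightarrow> 1"
  proof (rule tendsto_fpsI, rule eventually_sequentiallyI)
    fix n N :: nat assume "Suc n \<le> N"
    moreover have "N \<le> s * N" using assms(2) by simp
    ultimately have "n \<noteq> s * N" by linarith
    then show "fps_nth (?r N) n = fps_nth 1 n"
      by (simp flip: power_mult)
  qed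
  ultimately have "(\<lambda>N. (?A N * ?B N * ?q N) * ?r N) \<longlonglongrightarrow> theta s 0 w"
    using tendsto_mult_fps[of "\<lambda>N. ?A N * ?B N * ?q N" "theta s 0 w" ?r 1] by (simp only: mult_1_right)
  moreover have B: "?B N * ?r N = fps_const (1 + inverse w) * ?C N" for N
  proof -
    have "?B N * ?r N = ?B (Suc N)" by simp
    also have "\<dots> = fps_const (1 + inverse w) * ?C N"
      by (subst prod.lessThan_Suc_shift) (simp flip: fps_const_add)
    finally show ?thesis .
  qed
  have "(?A N * ?B N * ?q N) * ?r N = fps_const (1 + inverse w) * (?A N * ?C N * ?q N)" for N
  proof -
    have "(?A N * ?B N * ?q N) * ?r N = ?A N * (?B N * ?r N) * ?q N" by (simp only: mult_ac)
    then show ?thesis unfolding B by (simp only: mult_ac)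
  qed
  ultimately show ?thesis by (simp only:)
qed

section \<open>Product evaluations at \<open>w = 1\<close>\<close>

lemmas qpoch_lim = qpoch_tendsto_complex_euler_f qpoch_tendsto_complex_euler_f_1

lemma theta_2_0: "theta 2 0 1 * ef 2 = 2 * ef 4 ^ 2"
proof -
  let ?q = "fps_X ^ 2 :: complex fps"
  have "(\<lambda>N. 2 * (ppoch ?q N * ppoch ?q N * qpoch ?q N)) \<longlonglongrightarrow> theta 2 0 1"
    using jacobi_triple_product_0[of "1::complex" 2]
    by (simp add: ppoch_def numeral_fps_const)
  \<comment> \<open>Denominators are multiplied in before the limit, so only products have to
    converge; uniqueness of limits then gives the identity. The later evaluations follow the same
    scheme.\<close>
  then have "(\<lambda>N. 2 * (ppoch ?q N * ppoch ?q N * qpoch ?q N) * qpoch ?q N) \<longlonglongrightarrow> theta 2 0 1 * ef 2"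
    by (intro tendsto_mult_fps qpoch_lim) simp_all
  also have "(\<lambda>N. 2 * (ppoch ?q N * ppoch ?q N * qpoch ?q N) * qpoch ?q N) =
      (\<lambda>N. 2 * ((ppoch ?q N * qpoch ?q N) * (ppoch ?q N * qpoch ?q N)))"
    by (simp add: mult_ac)
  also have "\<dots> = (\<lambda>N. 2 * (qpoch (fps_X ^ 4) N * qpoch (fps_X ^ 4) N))"
    unfolding ppoch_mult_qpoch by (simp flip: power_mult)
  finally have "\<dots> \<longlonglongrightarrow> theta 2 0 1 * ef 2" .
  moreover have "(\<lambda>N. 2 * (qpoch (fps_X ^ 4) N * qpoch (fps_X ^ 4) N)) \<longlonglongrightarrow> 2 * (ef 4 * ef 4)"
    by (intro tendsto_mult_fps qpoch_lim tendsto_const) simp_all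
  ultimately have "theta 2 0 1 * ef 2 = 2 * (ef 4 * ef 4)"
    by (rule LIMSEQ_unique)
  then show ?thesis
    by (simp add: power2_eq_square)
qed

text \<open>The triple product is \<open>(-q;q^6) (-q^5;q^6) f_6\<close>, and its first two factors
  equal \<open>(-q;q^2) / (-q^3;q^6)\<close>.\<close>

lemma theta_5_1: "theta 5 1 1 * (ef 1 * ef 4 * ef 6) = ef 2 ^ 2 * ef 3 * ef 12"
proof -
  let ?q = "fps_X :: complex fps"
  define P where "P = (\<lambda>N. (\<Prod>i<N. 1 + ?q ^ (5 + 6 * i)) * (\<Prod>i<N. 1 + ?q ^ (1 + 6 * i)))"
  have P: "P N * opoch (?q ^ 3) N = opoch ?q (3 * N)" for N
    unfolding P_def by (rule prod_sixth_mult_opoch)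
  have o3: "opoch (?q ^ 3) N * (qpoch (?q ^ 12) N * qpoch (?q ^ 3) (2 * N)) =
      qpoch (?q ^ 6) (2 * N) * qpoch (?q ^ 6) N" for N
    using opoch_mult_qpoch[of "?q ^ 3" N] by (simp flip: power_mult)
  have o1: "opoch ?q (3 * N) * (qpoch (?q ^ 4) (3 * N) * qpoch (?q ^ 1) (6 * N)) =
      qpoch (?q ^ 2) (6 * N) * qpoch (?q ^ 2) (3 * N)" for N
    using opoch_mult_qpoch[of ?q "3 * N"] by simp
  have "(\<lambda>N. P N * qpoch (?q ^ 6) N) \<longlonglongrightarrow> theta 5 1 1"
    using jacobi_triple_product_1[of 1 5 1, where 'a = complex] by (simp add: P_def)
  then have "(\<lambda>N. (P N * qpoch (?q ^ 6) N) * ((qpoch (?q ^ 6) (2 * N) * qpoch (?q ^ 6) N) *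
      (qpoch (?q ^ 4) (3 * N) * qpoch (?q ^ 1) (6 * N)))) \<longlonglongrightarrow> theta 5 1 1 * ((ef 6 * ef 6) * (ef 4 * ef 1))"
    by (intro tendsto_mult_fps qpoch_lim) simp_all
  also have "(\<lambda>N. (P N * qpoch (?q ^ 6) N) * ((qpoch (?q ^ 6) (2 * N) * qpoch (?q ^ 6) N) *
      (qpoch (?q ^ 4) (3 * N) * qpoch (?q ^ 1) (6 * N)))) =
    (\<lambda>N. (P N * opoch (?q ^ 3) N) * (qpoch (?q ^ 4) (3 * N) * qpoch (?q ^ 1) (6 * N)) *
      (qpoch (?q ^ 6) N * qpoch (?q ^ 12) N * qpoch (?q ^ 3) (2 * N)))"
    unfolding o3[symmetric] by (simp only: mult_ac)
  also have "\<dots> = (\<lambda>N. (qpoch (?q ^ 2) (6 * N) * qpoch (?q ^ 2) (3 * N)) *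
      (qpoch (?q ^ 6) N * qpoch (?q ^ 12) N * qpoch (?q ^ 3) (2 * N)))"
    unfolding P o1 ..
  finally have "\<dots> \<longlonglongrightarrow> theta 5 1 1 * ((ef 6 * ef 6) * (ef 4 * ef 1))" .
  moreover have "(\<lambda>N. (qpoch (?q ^ 2) (6 * N) * qpoch (?q ^ 2) (3 * N)) *
      (qpoch (?q ^ 6) N * qpoch (?q ^ 12) N * qpoch (?q ^ 3) (2 * N))) \<longlonglongrightarrow> (ef 2 * ef 2) * (ef 6 * ef 12 * ef 3)"
    by (intro tendsto_mult_fps qpoch_lim) simp_all
  ultimately have "theta 5 1 1 * ((ef 6 * ef 6) * (ef 4 * ef 1)) = (ef 2 * ef 2) * (ef 6 * ef 12 * ef 3)"
    by (rule LIMSEQ_unique)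
  then have "ef 6 * (theta 5 1 1 * (ef 1 * ef 4 * ef 6)) = ef 6 * (ef 2 ^ 2 * ef 3 * ef 12)"
    by (simp add: power2_eq_square mult_ac)
  then show ?thesis
    by (simp add: complex_euler_f_nonzero)
qed

text \<open>The triple product is \<open>(-q^2;q^6) (-q^4;q^6) f_6\<close>, and its first two
  factors equal \<open>(-q^2;q^2) / (-q^6;q^6)\<close>.\<close>

lemma theta_4_2: "theta 4 2 1 * (ef 2 * ef 12) = ef 4 * ef 6 ^ 2"
proof -
  let ?q = "fps_X ^ 2 :: complex fps"
  define P where "P = (\<lambda>N. (\<Prod>i<N. 1 + ?q ^ (2 + 3 * i)) * (\<Prod>i<N. 1 + ?q ^ (1 + 3 * i)))"
  have P: "P N * ppoch (fps_X ^ 6) N = ppoch ?q (3 * N)" for N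
    using prod_third_mult_ppoch[of ?q N] unfolding P_def by (simp flip: power_mult)
  have p6: "ppoch (fps_X ^ 6) N * qpoch (fps_X ^ 6) N = (qpoch (fps_X ^ 12) N :: complex fps)" for N
    using ppoch_mult_qpoch[of "fps_X ^ 6 :: complex fps" N] by (simp flip: power_mult)
  have p2: "ppoch ?q (3 * N) * qpoch ?q (3 * N) = qpoch (fps_X ^ 4) (3 * N)" for N
    using ppoch_mult_qpoch[of ?q "3 * N"] by (simp flip: power_mult)
  have "(\<lambda>N. P N * qpoch (fps_X ^ 6) N) \<longlonglongrightarrow> theta 4 2 1"
    using jacobi_triple_product_1[of 2 2 1, where 'a = complex] by (simp add: P_def flip: power_mult)
  then have "(\<lambda>N. (P N * qpoch (fps_X ^ 6) N) * (qpoch ?q (3 * N) * qpoch (fps_X ^ 12) N))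
      \<longlonglongrightarrow> theta 4 2 1 * (ef 2 * ef 12)"
    by (intro tendsto_mult_fps qpoch_lim) simp_all
  also have "(\<lambda>N. (P N * qpoch (fps_X ^ 6) N) * (qpoch ?q (3 * N) * qpoch (fps_X ^ 12) N)) =
    (\<lambda>N. (P N * ppoch (fps_X ^ 6) N) * qpoch ?q (3 * N) * (qpoch (fps_X ^ 6) N * qpoch (fps_X ^ 6) N))"
    unfolding p6[symmetric] by (simp only: mult_ac)
  also have "\<dots> = (\<lambda>N. qpoch (fps_X ^ 4) (3 * N) * (qpoch (fps_X ^ 6) N * qpoch (fps_X ^ 6) N))"
    unfolding P p2 ..
  finally have "\<dots> \<longlonglongrightarrow> theta 4 2 1 * (ef 2 * ef 12)" .
  moreover have "(\<lambda>N. qpoch (fps_X ^ 4) (3 * N) * (qpoch (fps_X ^ 6) N * qpoch (fps_X ^ 6) N))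
      \<longlonglongrightarrow> ef 4 * (ef 6 * ef 6)"
    by (intro tendsto_mult_fps qpoch_lim) simp_all
  ultimately have "theta 4 2 1 * (ef 2 * ef 12) = ef 4 * (ef 6 * ef 6)"
    by (rule LIMSEQ_unique)
  then show ?thesis
    by (simp add: power2_eq_square)
qed

text \<open>The triple product collapses to \<open>(-q^2;q^4) f_8\<close>. Comparison with
  \<open>theta_2_0\<close> will show that \<open>theta 2 0 1\<close> is twice this series.\<close>

lemma theta_6_2: "theta 6 2 1 * ef 2 = ef 4 ^ 2"
proof -
  let ?q = "fps_X ^ 2 :: complex fps"
  have o: "opoch ?q (2 * N) * (qpoch (fps_X ^ 8) (2 * N) * qpoch ?q (4 * N)) =
      qpoch (fps_X ^ 4) (4 * N) * qpoch (fps_X ^ 4) (2 * N)" for N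
    using opoch_mult_qpoch[of ?q "2 * N"] by (simp flip: power_mult)
  have "(\<lambda>N. opoch ?q (2 * N) * qpoch (fps_X ^ 8) N) \<longlonglongrightarrow> theta 6 2 1"
    using jacobi_triple_product_1[of 2 3 1, where 'a = complex]
    unfolding prod_fourth_opoch[symmetric] by (simp flip: power_mult)
  then have "(\<lambda>N. (opoch ?q (2 * N) * qpoch (fps_X ^ 8) N) * (qpoch (fps_X ^ 8) (2 * N) * qpoch ?q (4 * N)))
      \<longlonglongrightarrow> theta 6 2 1 * (ef 8 * ef 2)"
    by (intro tendsto_mult_fps qpoch_lim) simp_all
  also have "(\<lambda>N. (opoch ?q (2 * N) * qpoch (fps_X ^ 8) N) * (qpoch (fps_X ^ 8) (2 * N) * qpoch ?q (4 * N))) =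
     (\<lambda>N. (qpoch (fps_X ^ 4) (4 * N) * qpoch (fps_X ^ 4) (2 * N)) * qpoch (fps_X ^ 8) N)"
    unfolding o[symmetric] by (simp only: mult_ac)
  finally have "\<dots> \<longlonglongrightarrow> theta 6 2 1 * (ef 8 * ef 2)" .
  moreover have "(\<lambda>N. (qpoch (fps_X ^ 4) (4 * N) * qpoch (fps_X ^ 4) (2 * N)) * qpoch (fps_X ^ 8) N)
      \<longlonglongrightarrow> (ef 4 * ef 4) * ef 8"
    by (intro tendsto_mult_fps qpoch_lim) simp_all
  ultimately have "theta 6 2 1 * (ef 8 * ef 2) = (ef 4 * ef 4) * ef 8"
    by (rule LIMSEQ_unique)
  then have "ef 8 * (theta 6 2 1 * ef 2) = ef 8 * ef 4 ^ 2"
    by (simp add: power2_eq_square mult_ac)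
  then show ?thesis
    by (simp add: complex_euler_f_nonzero)
qed

section \<open>Product evaluations at cube roots of unity\<close>

lemma cube_root_of_unity:
  fixes w :: "'a :: field"
  assumes "w\<^sup>2 + w + 1 = 0"
  shows "w \<noteq> 0" "w ^ 3 = 1" "inverse w = w\<^sup>2"
    and "(1 + fps_const w * x) * (1 + fps_const (w\<^sup>2) * x) * (1 + x) = 1 + x ^ 3"
proof -
  show "w \<noteq> 0" using assms by auto
  show w3: "w ^ 3 = 1"
    using assms by algebra
  show "inverse w = w\<^sup>2"
    using w3 by (intro inverse_unique) (simp add: power3_eq_cube power2_eq_square mult.assoc)
  define c where "c = fps_const w"
  have c: "fps_const (w\<^sup>2) = c\<^sup>2" by (simp add: c_def)
  have "c\<^sup>2 + c + 1 = fps_const (w\<^sup>2 + w + 1)" by (simp add: c_def flip: fps_const_add)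
  then have "c\<^sup>2 + c + 1 = 0" using assms by simp
  \<comment> \<open>In the triple products below, the factors with \<open>w\<close> and its inverse
    \<open>w\<^sup>2\<close> are completed by \<open>1 + x\<close>, leaving a product in the cube of
    the base.\<close>
  then show "(1 + fps_const w * x) * (1 + fps_const (w\<^sup>2) * x) * (1 + x) = 1 + x ^ 3"
    unfolding c unfolding c_def[symmetric] by algebra
qed

lemma theta_1_1_root:
  assumes "w\<^sup>2 + w + 1 = 0"
  shows "theta 1 1 w * (ef 2 * ef 3 * ef 12) = ef 1 * ef 4 * ef 6 ^ 2"
proof -
  note w = cube_root_of_unity[OF assms]
  let ?q = "fps_X :: complex fps"
  define P where "P = (\<lambda>N. (\<Prod>i<N. 1 + fps_const w * ?q ^ (2 * i + 1)) * (\<Prod>i<N. 1 + fps_const (w\<^sup>2) * ?q ^ (2 * i + 1)))"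
  have P: "P N * opoch ?q N = opoch (?q ^ 3) N" for N
    unfolding P_def opoch_def prod.distrib[symmetric] w(4)
    by (simp only: power_mult[symmetric] mult.commute)
  have o1: "opoch ?q N * (qpoch (?q ^ 4) N * qpoch (?q ^ 1) (2 * N)) =
      qpoch (?q ^ 2) (2 * N) * qpoch (?q ^ 2) N" for N
    using opoch_mult_qpoch[of ?q N] by simp
  have o3: "opoch (?q ^ 3) N * (qpoch (?q ^ 12) N * qpoch (?q ^ 3) (2 * N)) =
      qpoch (?q ^ 6) (2 * N) * qpoch (?q ^ 6) N" for N
    using opoch_mult_qpoch[of "?q ^ 3" N] by (simp flip: power_mult)
  have "(\<lambda>N. P N * qpoch (?q ^ 2) N) \<longlonglongrightarrow> theta 1 1 w"
    using jacobi_triple_product[of w 1 1] w by (simp add: P_def numeral_2_eq_2 del: power_Suc)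
  then have "(\<lambda>N. (P N * qpoch (?q ^ 2) N) * ((qpoch (?q ^ 2) (2 * N) * qpoch (?q ^ 2) N) *
      (qpoch (?q ^ 12) N * qpoch (?q ^ 3) (2 * N)))) \<longlonglongrightarrow> theta 1 1 w * ((ef 2 * ef 2) * (ef 12 * ef 3))"
    by (intro tendsto_mult_fps qpoch_lim) simp_all
  also have "(\<lambda>N. (P N * qpoch (?q ^ 2) N) * ((qpoch (?q ^ 2) (2 * N) * qpoch (?q ^ 2) N) *
      (qpoch (?q ^ 12) N * qpoch (?q ^ 3) (2 * N)))) =
      (\<lambda>N. (P N * opoch ?q N) * (qpoch (?q ^ 12) N * qpoch (?q ^ 3) (2 * N)) *
        (qpoch (?q ^ 2) N * qpoch (?q ^ 4) N * qpoch (?q ^ 1) (2 * N)))"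
    unfolding o1[symmetric] by (simp only: mult_ac)
  also have "\<dots> = (\<lambda>N. (qpoch (?q ^ 6) (2 * N) * qpoch (?q ^ 6) N) *
        (qpoch (?q ^ 2) N * qpoch (?q ^ 4) N * qpoch (?q ^ 1) (2 * N)))"
    unfolding P o3 ..
  finally have "\<dots> \<longlonglongrightarrow> theta 1 1 w * ((ef 2 * ef 2) * (ef 12 * ef 3))" .
  moreover have "(\<lambda>N. (qpoch (?q ^ 6) (2 * N) * qpoch (?q ^ 6) N) *
        (qpoch (?q ^ 2) N * qpoch (?q ^ 4) N * qpoch (?q ^ 1) (2 * N))) \<longlonglongrightarrow> (ef 6 * ef 6) * (ef 2 * ef 4 * ef 1)"
    by (intro tendsto_mult_fps qpoch_lim) simp_all
  ultimately have "theta 1 1 w * ((ef 2 * ef 2) * (ef 12 * ef 3)) = (ef 6 * ef 6) * (ef 2 * ef 4 * ef 1)"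
    by (rule LIMSEQ_unique)
  then have "ef 2 * (theta 1 1 w * (ef 2 * ef 3 * ef 12)) = ef 2 * (ef 1 * ef 4 * ef 6 ^ 2)"
    by (simp add: power2_eq_square mult_ac)
  then show ?thesis
    by (simp add: complex_euler_f_nonzero)
qed

lemma theta_2_0_root:
  assumes "w\<^sup>2 + w + 1 = 0"
  shows "theta 2 0 w * (ef 4 * ef 6) = fps_const (1 + w\<^sup>2) * (ef 2 ^ 2 * ef 12)"
proof -
  note w = cube_root_of_unity[OF assms]
  let ?q = "fps_X ^ 2 :: complex fps"
  define P where "P = (\<lambda>N. (\<Prod>i<N. 1 + fps_const w * ?q ^ Suc i) * (\<Prod>i<N. 1 + fps_const (w\<^sup>2) * ?q ^ Suc i))"
  have P: "P N * ppoch ?q N = ppoch (fps_X ^ 6) N" for N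
    unfolding P_def ppoch_def prod.distrib[symmetric] w(4)
    by (simp only: power_mult[symmetric] mult_ac) simp
  have p2: "ppoch ?q N * qpoch ?q N = qpoch (fps_X ^ 4) N" for N
    using ppoch_mult_qpoch[of ?q N] by (simp flip: power_mult)
  have p6: "ppoch (fps_X ^ 6) N * qpoch (fps_X ^ 6) N = (qpoch (fps_X ^ 12) N :: complex fps)" for N
    using ppoch_mult_qpoch[of "fps_X ^ 6 :: complex fps" N] by (simp flip: power_mult)
  have "(\<lambda>N. fps_const (1 + w\<^sup>2) * (P N * qpoch ?q N)) \<longlonglongrightarrow> theta 2 0 w"
    using jacobi_triple_product_0[of w 2] w by (simp add: P_def)
  then have "(\<lambda>N. (fps_const (1 + w\<^sup>2) * (P N * qpoch ?q N)) * (qpoch (fps_X ^ 4) N * qpoch (fps_X ^ 6) N))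
      \<longlonglongrightarrow> theta 2 0 w * (ef 4 * ef 6)"
    by (intro tendsto_mult_fps qpoch_lim) simp_all
  also have "(\<lambda>N. (fps_const (1 + w\<^sup>2) * (P N * qpoch ?q N)) * (qpoch (fps_X ^ 4) N * qpoch (fps_X ^ 6) N)) =
      (\<lambda>N. fps_const (1 + w\<^sup>2) * ((P N * ppoch ?q N) * qpoch (fps_X ^ 6) N * (qpoch ?q N * qpoch ?q N)))"
    unfolding p2[symmetric] by (simp only: mult_ac)
  also have "\<dots> = (\<lambda>N. fps_const (1 + w\<^sup>2) * (qpoch (fps_X ^ 12) N * (qpoch ?q N * qpoch ?q N)))"
    unfolding P p6 ..
  finally have "\<dots> \<longlonglongrightarrow> theta 2 0 w * (ef 4 * ef 6)" .
  moreover have "(\<lambda>N. fps_const (1 + w\<^sup>2) * (qpoch (fps_X ^ 12) N * (qpoch ?q N * qpoch ?q N)))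
      \<longlonglongrightarrow> fps_const (1 + w\<^sup>2) * (ef 12 * (ef 2 * ef 2))"
    by (intro tendsto_mult_fps qpoch_lim tendsto_const) simp_all
  ultimately have "theta 2 0 w * (ef 4 * ef 6) = fps_const (1 + w\<^sup>2) * (ef 12 * (ef 2 * ef 2))"
    by (rule LIMSEQ_unique)
  then show ?thesis
    by (simp add: power2_eq_square mult_ac)
qed

text \<open>Here the completing factors \<open>1 - x\<close> are those of \<open>qpoch\<close>
  itself, so everything collapses to \<open>f_3\<close> without denominators.\<close>

lemma theta_1_0_root:
  assumes "w\<^sup>2 + w + 1 = 0"
  shows "theta 1 0 (- w) = fps_const (1 - w\<^sup>2) * ef 3"
proof -
  note w = cube_root_of_unity[OF assms]
  have e: "(1 + fps_const (- w) * x) * (1 + fps_const (- w\<^sup>2) * x) * (1 - x) = 1 - x ^ 3" for x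
    using w(4)[of "- x"] by (simp flip: fps_const_neg)
  have "(\<Prod>i<N. 1 + fps_const (- w) * fps_X ^ Suc i) * (\<Prod>i<N. 1 + fps_const (- w\<^sup>2) * fps_X ^ Suc i) *
      qpoch fps_X N = qpoch (fps_X ^ 3) N" for N
    unfolding qpoch_def prod.distrib[symmetric] e
    by (simp only: power_mult[symmetric] mult.commute)
  then have "(\<lambda>N. fps_const (1 - w\<^sup>2) * qpoch (fps_X ^ 3) N) \<longlonglongrightarrow> theta 1 0 (- w)"
    using jacobi_triple_product_0[of "- w" 1] w by (simp del: power_Suc)
  moreover have "(\<lambda>N. fps_const (1 - w\<^sup>2) * qpoch (fps_X ^ 3) N) \<longlonglongrightarrow> fps_const (1 - w\<^sup>2) * ef 3"
    by (intro tendsto_mult_fps qpoch_lim tendsto_const) simp_all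
  ultimately show ?thesis by (rule LIMSEQ_unique)
qed

subsection \<open>Dissections\<close>

lemma bij_betw_even_lattice:
  "bij_betw (\<lambda>(u, v). (u + v, u - v)) UNIV {(i, j). even (i + j :: int)}"
  by (rule bij_betwI[where g = "\<lambda>(i, j). ((i + j) div 2, (i - j) div 2)"]) (auto, presburger+)

lemma bij_betw_odd_lattice:
  "bij_betw (\<lambda>(u, v). (u + v, u - v - 1)) UNIV {(i, j). odd (i + j :: int)}"
  by (rule bij_betwI[where g = "\<lambda>(i, j). ((i + j + 1) div 2, (i - j - 1) div 2)"]) (auto elim!: oddE, presburger+)

lemma theta_exp_simps:
  "theta_exp 1 1 n = n * n" "theta_exp 2 0 n = n * n + n" "theta_exp 5 1 n = 3 * n * n + 2 * n"
  "theta_exp 4 2 n = 3 * n * n + n" "theta_exp 6 2 n = 4 * n * n + 2 * n"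
  using two_theta_exp[of 1 1 n] two_theta_exp[of 2 0 n] two_theta_exp[of 5 1 n]
    two_theta_exp[of 4 2 n] two_theta_exp[of 6 2 n]
  by (simp_all add: algebra_simps)

lemma theta_mult:
  assumes "a + b > 0" "c + d > 0"
  shows "theta a b w * theta c d v =
    gsum UNIV (\<lambda>(i, j). theta_exp a b i + theta_exp c d j) (\<lambda>(i, j). w powi i * v powi j)"
  unfolding theta_def using gsum_mult[OF admissible_theta_exp[OF assms(1)] admissible_theta_exp[OF assms(2)]]
  by simp

lemma admissible_theta_exp_Times:
  assumes "a + b > 0" "c + d > 0"
  shows "admissible UNIV (\<lambda>(i, j). theta_exp a b i + theta_exp c d j)"
  using admissible_Times[OF admissible_theta_exp[OF assms(1)] admissible_theta_exp[OF assms(2)]] by simp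

lemma theta_mult_split:
  assumes "a + b > 0" "c + d > 0"
  shows "theta a b w * theta c d v =
    gsum {(i, j). even (i + j)} (\<lambda>(i, j). theta_exp a b i + theta_exp c d j) (\<lambda>(i, j). w powi i * v powi j) +
    gsum {(i, j). odd (i + j)} (\<lambda>(i, j). theta_exp a b i + theta_exp c d j) (\<lambda>(i, j). w powi i * v powi j)"
proof -
  have U: "UNIV = {(i, j). even (i + j :: int)} \<union> {(i, j). odd (i + j)}"
    by auto
  show ?thesis
    unfolding theta_mult[OF assms] U
    by (rule gsum_Un) (use admissible_theta_exp_Times[OF assms] U in auto)
qed

text \<open>The index pairs are split by the parity of \<open>i + j\<close>. In the coordinates
  \<open>u\<close>, \<open>v\<close> of the two sublattices the quadratic exponent separates, and
  the weight depends on \<open>v\<close> alone.\<close>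

lemma theta_1_0_mult:
  fixes w :: "'a :: field"
  assumes "w \<noteq> 0"
  shows "theta 1 0 (- w) * theta 1 0 (- inverse w) =
    theta 2 0 1 * theta 1 1 (w\<^sup>2) - fps_const w * (theta 1 1 1 * theta 2 0 (w\<^sup>2))"
proof -
  let ?e = "\<lambda>(i, j). theta_exp 1 0 i + theta_exp 1 0 j"
    and ?x = "\<lambda>(i, j). (- w) powi i * (- inverse w) powi j"
  have x: "(- w) powi i * (- inverse w) powi j = (- 1) powi (i + j) * w powi (i - j)" for i j
  proof -
    have "(- w) powi i * (- inverse w) powi j = ((-1) * w) powi i * ((-1) * inverse w) powi j" by simp
    also have "\<dots> = (- 1) powi (i + j) * w powi (i - j)"
      unfolding power_int_mult_distrib using assms
      by (simp add: power_int_add power_int_diff power_int_inverse divide_inverse)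
    finally show ?thesis .
  qed
  have odd: "(- w) powi (u + v) * (- inverse w) powi (u - v - 1) = - w * w\<^sup>2 powi v" for u v
  proof -
    \<comment> \<open>On the odd sublattice \<open>i + j = 2 * u - 1\<close> and
      \<open>i - j = 2 * v + 1\<close>, which produces the sign and the extra factor
      \<open>w\<close>.\<close>
    have "(- w) powi (u + v) * (- inverse w) powi (u - v - 1) = (- 1) powi (2 * u - 1) * w powi (2 * v + 1)"
      unfolding x by (rule arg_cong2[where f = "\<lambda>m n. (- 1) powi m * w powi n"]) simp_all
    also have "(- 1) powi (2 * u - 1) = (- 1 :: 'a)"
      by (simp add: power_int_minus_left_odd)
    also have "w powi (2 * v + 1) = w\<^sup>2 powi v * w"
      using assms by (simp add: power_int_add power_int_mult flip: power_int_numeral)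
    finally show ?thesis by simp
  qed
  have e: "theta_exp 1 0 (u + v) + theta_exp 1 0 (u - v) = theta_exp 2 0 u + theta_exp 1 1 v"
    "theta_exp 1 0 (u + v) + theta_exp 1 0 (u - v - 1) = theta_exp 1 1 u + theta_exp 2 0 v" for u v
    using two_theta_exp[of 1 0 "u + v"] two_theta_exp[of 1 0 "u - v"] two_theta_exp[of 1 0 "u - v - 1"]
    by (simp_all add: theta_exp_simps algebra_simps del: One_nat_def)
  have 1: "gsum {(i, j). even (i + j)} ?e ?x = theta 2 0 1 * theta 1 1 (w\<^sup>2)"
    by (subst theta_mult, simp, simp, rule gsum_reindex[OF bij_betw_even_lattice])
       (use assms in \<open>auto simp: x e power_int_mult simp del: One_nat_def simp flip: power_int_numeral\<close>)
  have 2: "gsum {(i, j). odd (i + j)} ?e ?x = fps_const (- w) * (theta 1 1 1 * theta 2 0 (w\<^sup>2))"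
    by (subst theta_mult, simp, simp, subst gsum_const_mult[symmetric], rule gsum_reindex[OF bij_betw_odd_lattice]) (auto simp: odd e simp del: One_nat_def)
  have "theta 1 0 (- w) * theta 1 0 (- inverse w) =
      gsum {(i, j). even (i + j)} ?e ?x + gsum {(i, j). odd (i + j)} ?e ?x"
    by (rule theta_mult_split) simp_all
  then show ?thesis
    unfolding 1 2 by (simp flip: fps_const_neg)
qed

text \<open>The pairs fall into three classes: \<open>i + j\<close> even, only \<open>i\<close> odd,
  only \<open>j\<close> odd. In the last two all exponents are 1 modulo 4, hence the substitution of
  \<open>fps_X ^ 4\<close> and the factor \<open>fps_X\<close>.\<close>

lemma theta_1_1_mult_theta_5_1:
  "(theta 1 1 1 * theta 5 1 1 :: 'a :: field fps) = theta 6 2 1 * theta 4 2 1 +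
    fps_X * ((theta 2 0 1 * theta 4 2 1 + theta 1 1 1 * theta 5 1 1) oo fps_X ^ 4)"
proof -
  let ?e = "\<lambda>(i, j). theta_exp 1 1 i + theta_exp 5 1 j" and ?x = "\<lambda>(i, j). 1 powi i * 1 powi j :: 'a"
  \<comment> \<open>The point \<open>(s - t, s + t)\<close> has exponent \<open>((2 s + 4 t + 1)\<^sup>2 - 1) / 4 + 3 s\<^sup>2 + s\<close>,
    so \<open>n\<close> is chosen with \<open>4 n + 1 = \<plusminus> (2 s + 4 t + 1)\<close>, the sign being fixed by the parity of \<open>s\<close>.\<close>
  let ?t = "\<lambda>(n :: int, s :: int). if even s then n - s div 2 else - (s div 2) - 1 - n"
  have "bij_betw (\<lambda>(n, s). (s - ?t (n, s), s + ?t (n, s))) UNIV {(i, j). even (i + j :: int)}"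
    by (rule bij_betwI[where g = "\<lambda>(i, j). (let s = (i + j) div 2; t = (j - i) div 2 in
        if even s then t + s div 2 else - (s div 2) - 1 - t, (i + j) div 2)"])
       (auto simp: Let_def, presburger+)
  then have even: "gsum {(i, j). even (i + j)} ?e ?x = theta 6 2 1 * theta 4 2 1"
    by (subst theta_mult, simp, simp, rule gsum_reindex) (auto simp: theta_exp_simps algebra_simps simp del: One_nat_def elim!: evenE oddE)
  \<comment> \<open>Substituting \<open>fps_X ^ 4\<close> and multiplying by \<open>fps_X\<close>
    changes an exponent \<open>e\<close> to \<open>4 * e + 1\<close>.\<close>
  have scale: "fps_X * (theta a b 1 * theta c d 1 oo fps_X ^ 4) =
      (gsum UNIV (\<lambda>(i, j). 4 * (theta_exp a b i + theta_exp c d j) + 1) (\<lambda>_. 1) :: 'a fps)"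
    if "a + b > 0" "c + d > 0" for a b c d
  proof -
    have "admissible UNIV (\<lambda>x. 4 * (case x of (i, j) \<Rightarrow> theta_exp a b i + theta_exp c d j))"
      unfolding admissible_def
    proof (intro conjI allI ballI)
      fix k
      let ?f = "\<lambda>x. case x of (i, j) \<Rightarrow> theta_exp a b i + theta_exp c d j"
      have "0 \<le> ?f x" for x
        by (auto simp: theta_exp_nonneg split: prod.split)
      then have "{x \<in> UNIV. 4 * ?f x \<le> k} \<subseteq> {x \<in> UNIV. ?f x \<le> k}"
        by (smt (verit) mem_Collect_eq subsetI)
      moreover have "finite {x \<in> UNIV. ?f x \<le> k}"
        using admissible_theta_exp_Times[OF that] unfolding admissible_def by blast
      ultimately show "finite {x \<in> UNIV. 4 * ?f x \<le> k}"
        by (rule finite_subset)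
    qed (auto simp: theta_exp_nonneg)
    then show ?thesis
      using that by (simp add: theta_mult gsum_compose gsum_X_mult case_prod_unfold)
  qed
  \<comment> \<open>Here \<open>i * i = 4 * (u * u + u) + 1\<close> and
    \<open>3 * j * j + 2 * j = 4 * (3 * v * v + v)\<close>.\<close>
  have "bij_betw (\<lambda>(u, v). (2 * u + 1, 2 * v)) UNIV {(i, j). odd (i :: int) \<and> even (j :: int)}"
    by (rule bij_betwI[where g = "\<lambda>(i, j). (i div 2, j div 2)"]) (auto elim!: evenE oddE, presburger)
  then have "gsum {(i, j). odd i \<and> even j} ?e ?x =
      gsum UNIV (\<lambda>(i, j). 4 * (theta_exp 2 0 i + theta_exp 4 2 j) + 1) (\<lambda>_. 1)"
    by (rule gsum_reindex) (auto simp: theta_exp_simps algebra_simps simp del: One_nat_def)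
  also have "\<dots> = fps_X * (theta 2 0 1 * theta 4 2 1 oo fps_X ^ 4)"
    by (rule scale[symmetric]) simp_all
  finally have odd1: "gsum {(i, j). odd i \<and> even j} ?e ?x = fps_X * (theta 2 0 1 * theta 4 2 1 oo fps_X ^ 4)" .
  \<comment> \<open>The negative sign is chosen because then
    \<open>3 * j * j + 2 * j = 4 * (3 * v * v + 2 * v) + 1\<close>, which reproduces the exponent of
    \<open>theta 5 1\<close>.\<close>
  have "bij_betw (\<lambda>(u, v). (2 * u, - 2 * v - 1)) UNIV {(i, j). even (i :: int) \<and> odd (j :: int)}"
    by (rule bij_betwI[where g = "\<lambda>(i, j). (i div 2, (- j - 1) div 2)"]) (auto elim!: evenE oddE, presburger)
  then have "gsum {(i, j). even i \<and> odd j} ?e ?x =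
      gsum UNIV (\<lambda>(i, j). 4 * (theta_exp 1 1 i + theta_exp 5 1 j) + 1) (\<lambda>_. 1)"
    by (rule gsum_reindex) (auto simp: theta_exp_simps algebra_simps simp del: One_nat_def)
  also have "\<dots> = fps_X * (theta 1 1 1 * theta 5 1 1 oo fps_X ^ 4)"
    by (rule scale[symmetric]) simp_all
  finally have odd2: "gsum {(i, j). even i \<and> odd j} ?e ?x = fps_X * (theta 1 1 1 * theta 5 1 1 oo fps_X ^ 4)" .
  have "{(i, j). odd (i + j)} = {(i :: int, j :: int). odd i \<and> even j} \<union> {(i, j). even i \<and> odd j}"
    by auto
  moreover have "gsum ({(i, j). odd i \<and> even j} \<union> {(i, j). even i \<and> odd j}) ?e ?x =
      gsum {(i, j). odd i \<and> even j} ?e ?x + gsum {(i, j). even i \<and> odd j} ?e ?x"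
    by (rule gsum_Un) (auto intro: admissible_subset[OF admissible_theta_exp_Times])
  ultimately have odd: "gsum {(i, j). odd (i + j)} ?e ?x =
      fps_X * (theta 2 0 1 * theta 4 2 1 oo fps_X ^ 4) + fps_X * (theta 1 1 1 * theta 5 1 1 oo fps_X ^ 4)"
    by (simp only: odd1 odd2)
  have "theta 1 1 1 * theta 5 1 1 = gsum {(i, j). even (i + j)} ?e ?x + gsum {(i, j). odd (i + j)} ?e ?x"
    by (rule theta_mult_split) simp_all
  then show ?thesis
    unfolding even odd by (simp add: fps_compose_add_distrib distrib_left)
qed

section \<open>The cubic theta identity and the 2-dissection\<close>

theorem cubic_theta_identity:
  "(theta 1 1 1 * theta 5 1 1 + theta 2 0 1 * theta 4 2 1) * ef 1 = 3 * ef 3 ^ 3"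
proof -
  define w where "w = Complex (- 1 / 2) (sqrt 3 / 2)"
  have w: "w\<^sup>2 + w + 1 = 0"
    by (simp add: w_def complex_eq_iff power2_eq_square)
  note w' = cube_root_of_unity[OF w]
  have w2: "(w\<^sup>2)\<^sup>2 + w\<^sup>2 + 1 = 0" and w4: "(w\<^sup>2)\<^sup>2 = w"
    using w by algebra+
  \<comment> \<open>The factor \<open>- w\<close> normalises the constant \<open>1 + w\<close> from
    \<open>theta_2_0_root\<close> to 1. Up to the common factor \<open>f_1 / f_3\<close>,
    \<open>A\<close> and \<open>B\<close> are \<open>theta 5 1 1\<close> and
    \<open>theta 4 2 1\<close>.\<close>
  define A where "A = fps_const (- w) * theta 2 0 (w\<^sup>2)"
  define B where "B = theta 1 1 (w\<^sup>2)"
  have A: "A * (ef 4 * ef 6) = ef 2 ^ 2 * ef 12"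
  proof -
    have "A * (ef 4 * ef 6) = fps_const (- w * (1 + w)) * (ef 2 ^ 2 * ef 12)"
      unfolding A_def mult.assoc theta_2_0_root[OF w2] w4 by (simp flip: mult.assoc)
    also have "- w * (1 + w) = 1" using w by algebra
    finally show ?thesis by simp
  qed
  have B: "B * (ef 2 * ef 3 * ef 12) = ef 1 * ef 4 * ef 6 ^ 2"
    unfolding B_def by (rule theta_1_1_root[OF w2])
  \<comment> \<open>These are the constants in the evaluations of \<open>theta 1 0\<close> at
    \<open>- w\<close> and at its conjugate.\<close>
  have "(1 - w\<^sup>2) * (1 - w) = 3"
    using w by algebra
  moreover have "fps_const ((1 - w\<^sup>2) * (1 - w)) * (ef 3 * ef 3) = theta 2 0 1 * B + theta 1 1 1 * A"
    using theta_1_0_mult[OF w'(1)] theta_1_0_root[OF w] theta_1_0_root[OF w2]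
    unfolding w'(3) w4 A_def B_def by (simp add: mult_ac flip: fps_const_mult fps_const_neg)
  ultimately have 3: "3 * ef 3 ^ 2 = theta 2 0 1 * B + theta 1 1 1 * A"
    by (simp add: power2_eq_square numeral_fps_const)
  have nz: "ef m \<noteq> 0" if "m \<ge> 1" for m
    using that by (rule complex_euler_f_nonzero)
  have "(theta 5 1 1 * ef 1) * (ef 4 * ef 6) = (A * ef 3) * (ef 4 * ef 6)"
    using theta_5_1 A by algebra
  then have 5: "theta 5 1 1 * ef 1 = A * ef 3"
    by (simp add: nz)
  have "(theta 4 2 1 * ef 1) * (ef 2 * ef 12) = (B * ef 3) * (ef 2 * ef 12)"
    using theta_4_2 B by algebra
  then have 4: "theta 4 2 1 * ef 1 = B * ef 3"
    by (simp add: nz)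
  show ?thesis
    using 3 4 5 by algebra
qed

text \<open>The dissection of \<open>f_3^3 / f_1\<close>, multiplied by
  \<open>f_1 f_2^2 f_4 f_12\<close> to remove all denominators.\<close>

theorem euler_f_2_dissection:
  "euler_f 3 ^ 3 * euler_f 2 ^ 2 * euler_f 4 * euler_f 12 =
    euler_f 1 * (euler_f 4 ^ 4 * euler_f 6 ^ 2 + fps_X * euler_f 2 ^ 2 * euler_f 12 ^ 4)"
proof -
  define G where "G = theta 1 1 1 * theta 5 1 1 + theta 2 0 1 * theta 4 2 (1 :: complex)"
  define H where "H = G oo fps_X ^ 4"
  have nz: "ef m \<noteq> 0" if "m \<ge> 1" for m
    using that by (rule complex_euler_f_nonzero)
  have efc: "ef m oo fps_X ^ 4 = ef (4 * m)" if "m \<ge> 1" for m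
    using that by (simp add: euler_f_compose flip: complex_fps_compose)
  have X0: "fps_nth (fps_X ^ 4 :: complex fps) 0 = 0" by simp
  have G: "G * ef 1 = 3 * ef 3 ^ 3"
    unfolding G_def by (rule cubic_theta_identity)
  then have "(G * ef 1) oo fps_X ^ 4 = (3 * ef 3 ^ 3) oo fps_X ^ 4"
    by simp
  then have H: "H * ef 4 = 3 * ef 12 ^ 3"
    by (simp add: H_def fps_compose_mult_distrib[OF X0] efc flip: fps_compose_power[OF X0])
  have "theta 2 0 1 * ef 2 = (2 * theta 6 2 1) * ef 2"
    using theta_2_0 theta_6_2 by (simp add: mult.assoc)
  then have "theta 2 0 1 = 2 * theta 6 2 (1 :: complex)"
    using nz[of 2] by simp
  \<comment> \<open>One copy of \<open>theta 6 2 1 * theta 4 2 1\<close> comes from the even lattice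
    points, two more from \<open>theta 2 0 1 * theta 4 2 1\<close>.\<close>
  then have "G = 3 * (theta 6 2 1 * theta 4 2 1) + fps_X * H"
    using theta_1_1_mult_theta_5_1[where 'a = complex] by (simp add: G_def H_def algebra_simps)
  then have "3 * (ef 3 ^ 3 * ef 2 ^ 2 * ef 4 * ef 12) = 3 * (ef 1 * (ef 4 ^ 4 * ef 6 ^ 2 + fps_X * ef 2 ^ 2 * ef 12 ^ 4))"
    using G H theta_6_2 theta_4_2 by algebra
  then have "ef 3 ^ 3 * ef 2 ^ 2 * ef 4 * ef 12 = ef 1 * (ef 4 ^ 4 * ef 6 ^ 2 + fps_X * ef 2 ^ 2 * ef 12 ^ 4)"
    by simp
  then show ?thesis
    unfolding complex_fps_eq_iff[symmetric] complex_fps_simps complex_fps_power .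
qed


section \<open>Separation of even and odd powers\<close>

theorem theorem3p1:
  shows "Abs_fps (\<lambda>n. CP3 (2 * n)) =
           (euler_f 2 ^ 6 * euler_f 3 ^ 10) / (euler_f 1 ^ 6 * euler_f 6 ^ 2)
           + fps_X * ((euler_f 3 ^ 6 * euler_f 6 ^ 6) / (euler_f 1 ^ 2 * euler_f 2 ^ 2))
    \<and> Abs_fps (\<lambda>n. CP3 (2 * n + 1)) =
           2 * ((euler_f 2 ^ 2 * euler_f 3 ^ 8 * euler_f 6 ^ 2) / euler_f 1 ^ 4)"
proof -
  let ?f = euler_f
  define p where "p = (?f 2 ^ 6 * ?f 3 ^ 10) / (?f 1 ^ 6 * ?f 6 ^ 2)"
  define r where "r = (?f 3 ^ 6 * ?f 6 ^ 6) / (?f 1 ^ 2 * ?f 2 ^ 2)"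
  define v where "v = (?f 2 ^ 2 * ?f 3 ^ 8 * ?f 6 ^ 2) / ?f 1 ^ 4"
  have nth0: "fps_nth (?f m) 0 = 1" if "m \<ge> 1" for m
    using that by (rule euler_f_has_prod(2))
  then have nz: "?f m \<noteq> 0" if "m \<ge> 1" for m
    using that by (metis fps_zero_nth zero_neq_one)
  have unit: "is_unit (?f m ^ k)" if "m \<ge> 1" for m k
    using nth0[OF that] by simp
  \<comment> \<open>The denominators are units, so each quotient is characterised by a product
    equation.\<close>
  have p: "p * (?f 1 ^ 6 * ?f 6 ^ 2) = ?f 2 ^ 6 * ?f 3 ^ 10"
    and r: "r * (?f 1 ^ 2 * ?f 2 ^ 2) = ?f 3 ^ 6 * ?f 6 ^ 6"
    and v: "v * ?f 1 ^ 4 = ?f 2 ^ 2 * ?f 3 ^ 8 * ?f 6 ^ 2"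
    unfolding p_def r_def v_def
    by (rule dvd_div_mult_self, rule unit_imp_dvd, simp add: unit is_unit_mult_iff del: fps_is_unit_iff)+
  have X0: "fps_nth (fps_X ^ 2 :: rat fps) 0 = 0" by simp
  let ?c = "\<lambda>g. g oo fps_X ^ 2 :: rat fps"
  have fc: "?c (?f m ^ k) = ?f (2 * m) ^ k" if "m \<ge> 1" for m k
    using that euler_f_compose[of m 2] fps_compose_power[OF X0, of "?f m" k] by simp
  have "?c (p * (?f 1 ^ 6 * ?f 6 ^ 2)) = ?c (?f 2 ^ 6 * ?f 3 ^ 10)" using p by simp
  then have p': "?c p * (?f 2 ^ 6 * ?f 12 ^ 2) = ?f 4 ^ 6 * ?f 6 ^ 10"
    by (simp add: fps_compose_mult_distrib[OF X0] fc)
  have "?c (r * (?f 1 ^ 2 * ?f 2 ^ 2)) = ?c (?f 3 ^ 6 * ?f 6 ^ 6)" using r by simp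
  then have r': "?c r * (?f 2 ^ 2 * ?f 4 ^ 2) = ?f 6 ^ 6 * ?f 12 ^ 6"
    by (simp add: fps_compose_mult_distrib[OF X0] fc)
  have "?c (v * ?f 1 ^ 4) = ?c (?f 2 ^ 2 * ?f 3 ^ 8 * ?f 6 ^ 2)" using v by simp
  then have v': "?c v * ?f 2 ^ 4 = ?f 4 ^ 2 * ?f 6 ^ 8 * ?f 12 ^ 2"
    by (simp add: fps_compose_mult_distrib[OF X0] fc)
  \<comment> \<open>A common denominator: it turns \<open>r\<close> into the square of the left side
    of the dissection times \<open>?f 6 ^ 6\<close>, and it is a multiple of the denominators in
    \<open>p'\<close>, \<open>r'\<close> and \<open>v'\<close>.\<close>
  define d where "d = ?f 1 ^ 2 * ?f 2 ^ 6 * ?f 4 ^ 2 * ?f 12 ^ 2"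
  have "r * d = (?f 3 ^ 3 * ?f 2 ^ 2 * ?f 4 * ?f 12) ^ 2 * ?f 6 ^ 6"
  proof -
    have "r * d = (r * (?f 1 ^ 2 * ?f 2 ^ 2)) * (?f 2 ^ 4 * ?f 4 ^ 2 * ?f 12 ^ 2)"
      unfolding d_def by algebra
    then show ?thesis unfolding r by algebra
  qed
  \<comment> \<open>The expanded square is grouped so that the right sides of \<open>p'\<close>,
    \<open>r'\<close> and \<open>v'\<close> appear verbatim.\<close>
  also have "\<dots> = ?f 1 ^ 2 * (?f 4 ^ 2 * (?f 4 ^ 6 * ?f 6 ^ 10) +
      fps_X ^ 2 * (?f 2 ^ 4 * ?f 12 ^ 2 * (?f 6 ^ 6 * ?f 12 ^ 6)) +
      2 * fps_X * (?f 2 ^ 2 * ?f 4 ^ 2 * ?f 12 ^ 2 * (?f 4 ^ 2 * ?f 6 ^ 8 * ?f 12 ^ 2)))"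
    unfolding euler_f_2_dissection by algebra
  also have "\<dots> = (?c p + fps_X ^ 2 * ?c r + 2 * fps_X * ?c v) * d"
    unfolding p'[symmetric] r'[symmetric] v'[symmetric] d_def by algebra
  finally have "r = ?c p + fps_X ^ 2 * ?c r + 2 * fps_X * ?c v"
    by (simp add: d_def nz)
  then have CP3: "CP3_gf = ?c p + fps_X ^ 2 * ?c r + fps_X * ?c (2 * v)"
    unfolding CP3_gf_def r_def[symmetric]
    by (simp add: fps_compose_mult_distrib[OF X0] mult_ac)
  \<comment> \<open>The term with \<open>fps_X ^ 2\<close> amounts to \<open>fps_X * r\<close> with
    \<open>fps_X ^ 2\<close> substituted, and it contributes nothing at \<open>n = 0\<close>; the
    last summand has only odd powers.\<close>
  have CP3_even: "CP3 (2 * n) = fps_nth (p + fps_X * r) n" for n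
    by (cases n) (simp_all add: CP3_def CP3 fps_X_power_mult_nth fps_compose_fps_X_power_nth)
  have CP3_odd: "CP3 (2 * n + 1) = fps_nth (2 * v) n" for n
    by (simp add: CP3_def CP3 fps_X_power_mult_nth fps_compose_fps_X_power_nth)
  show ?thesis
    unfolding p_def[symmetric] r_def[symmetric] v_def[symmetric] fps_eq_iff
    by (simp only: fps_nth_Abs_fps CP3_even CP3_odd simp_thms)
qed

end
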